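(* Let $N\ge 1$ and $n_x\ge 1$ be integers, let $A_1,\dots,A_N\in\mathbb{R}^{n_x\times n_x}$, and consider the discrete-time switched linear system $x(k+1)=A_{\sigma(k)}x(k)$, $k\in\mathbb{N}$. Let $1\le\tau_{\min}\le\tau_{\max}<\infty$ be integers and $d=\tau_{\max}-\tau_{\min}+1$. Then the switched system is globally uniformly asymptotically stable (GUAS) under every switching signal $\sigma\in\mathcal{D}_{[\tau_{\min},\tau_{\max}]}$ if and only if there exists an integer $L\ge 1$ such that, with $M=N(N-1)^{L-1}d^{L}$ and with $(i_{h,1},\dots,i_{h,L})$, $(\tau_{h,1},\dots,\tau_{h,L})$, $h\in\{1,\dots,M\}$, the enumeration of all $L$-switching-cycles and $T_h=\sum_{\ell=1}^{L}\tau_{h,\ell}$, statement (a) or statement (b) below holds: (a) There exist matrix sequences $P_h:\{0,1,\dots,T_h\}\to\mathbb{S}^{n_x}_{\succ 0}$, $h\in\{1,\dots,M\}$, such that $$A_{i_{h,\ell}}^{\top}P_h(k+1)A_{i_{h,\ell}}-P_h(k)\prec 0$$ for all $h\in\{1,\dots,M\}$, all $\ell\in\{1,\dots,L\}$ and all integers $k$ with $\sum_{s=1}^{\ell-1}\tau_{h,s}\le k\le \sum_{s=1}^{\ell}\tau_{h,s}-1$ (that is, for every $k\in\{0,\dots,T_h-1\}$, with $i_{h,\ell}$ the subsystem active at step $k$ of the $h$-th cycle), and $$P_h(0)-P_q(T_q)\prec 0\quad\text{for all } h,q\in\{1,\dots,M\}.$$ (b) There exist matrices $P_h\in\mathbb{S}^{n_x}_{\succ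 0}$, $h\in\{1,\dots,M\}$, such that $$\Phi_h^{\top}P_h\Phi_h-P_q\prec 0\quad\text{for all } h,q\in\{1,\dots,M\},$$ where $\Phi_h=\prod_{\ell=0}^{L-1}A_{i_{h,L-\ell}}^{\tau_{h,L-\ell}}=A_{i_{h,L}}^{\tau_{h,L}}A_{i_{h,L-1}}^{\tau_{h,L-1}}\cdots A_{i_{h,1}}^{\tau_{h,1}}$. The equivalence holds both with condition (a) and with condition (b) as the right-hand side.
   Context: $\mathbb{N}=\{0,1,2,\dots\}$ is the set of natural numbers. $\mathbb{S}^{n}_{\succ 0}$ is the set of real symmetric positive definite $n\times n$ matrices; $X\succ Y$ (equivalently $Y\prec X$) means that $X-Y$ is symmetric positive definite. Switching signals: a switching signal is a function $\sigma:\mathbb{N}\to\{1,\dots,N\}$. Its switching sequence is $\{k_n\}_{n\in\mathbb{N}}$, where $k_0=0$ is the initial time and $k_1<k_2<\cdots$ are the discontinuity points of $\sigma$ (the times at which the value of $\sigma$ changes; $\sigma$ is constant on $\{k_n,\dots,k_{n+1}-1\}$ and $\sigma(k_{n+1})\ne\sigma(k_n)$). $\mathcal{D}_{[\tau_{\min},\tau_{\max}]}$ is the set of all switching signals for which $k_{n+1}-k_n\in[\tau_{\min},\tau_{\max}]$ for all $n\in\mathbb{N}$. $L$-switching-cycles: an $L$-switching-cycle is a pair consisting of a sequence of subsystem indices $(i_1,\dots,i_L)\in\{1,\dots,N\}^L$ with $i_\ell\ne i_{\ell+1}$ for $\ell\in\{1,\dots,L-1\}$ and a sequence of integer activation times $(\tau_1,\dots,\tau_L)$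 with each $\tau_\ell\in[\tau_{\min},\tau_{\max}]$ ($i_1$ is active for the first $\tau_1$ steps, then $i_2$ for $\tau_2$ steps, and so on). There are exactly $M=N(N-1)^{L-1}d^L$ such pairs, and $h\in\{1,\dots,M\}$ enumerates all of them. Class $\mathcal{K}$ and $\mathcal{KL}$: a continuous $\alpha:\mathbb{R}^+\to\mathbb{R}^+$ ($\mathbb{R}^+=[0,\infty)$) is of class $\mathcal{K}$ if it is strictly increasing and $\alpha(0)=0$. A function $\beta:\mathbb{R}^+\times\mathbb{R}^+\to\mathbb{R}^+$ is of class $\mathcal{KL}$ if $\beta(\cdot,s)$ is of class $\mathcal{K}$ for each fixed $s$ and, for each fixed $r$, $\beta(r,\cdot)$ is decreasing (in the non-strict sense) with $\beta(r,s)\to0$ as $s\to\infty$. GUAS: the equilibrium $x=0$ of the system is GUAS under the switching signal $\sigma$ if, for any initial condition $x(0)$, there exists a class $\mathcal{KL}$ function $\beta$ such that the solution satisfies $\|x(k)\|\le\beta(\|x(0)\|,k)$ for all $k\in\mathbb{N}$. *)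

theory Defs
  imports "HOL-Analysis.Analysis"
begin

definition pos_def :: "real^'n^'n \<Rightarrow> bool" where
  "pos_def X \<longleftrightarrow> transpose X = X \<and> (\<forall>x. x \<noteq> 0 \<longrightarrow> x \<bullet> (X *v x) > 0)"

definition pd_less :: "real^'n^'n \<Rightarrow> real^'n^'n \<Rightarrow> bool" (infix "\<prec>\<^sub>p\<^sub>d" 50) where
  "Y \<prec>\<^sub>p\<^sub>d X \<longleftrightarrow> pos_def (X - Y)"

(* On real^'n^'n, ( * ) and (^) act componentwise, so the matrix power is defined separately. *)
primrec matpow :: "real^'n^'n \<Rightarrow> nat \<Rightarrow> real^'n^'n" where
  "matpow X 0 = mat 1"
| "matpow X (Suc n) = X ** matpow X n"

primrec solution :: "(nat \<Rightarrow> real^'n^'n) \<Rightarrow> (nat \<Rightarrow> nat) \<Rightarrow> real^'n \<Rightarrow> nat \<Rightarrow> real^'n" where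
  "solution A \<sigma> x0 0 = x0"
| "solution A \<sigma> x0 (Suc k) = A (\<sigma> k) *v solution A \<sigma> x0 k"

definition class_K :: "(real \<Rightarrow> real) \<Rightarrow> bool" where
  "class_K \<alpha> \<longleftrightarrow> \<alpha> \<in> {0..} \<rightarrow> {0..} \<and> continuous_on {0..} \<alpha> \<and> strict_mono_on {0..} \<alpha> \<and> \<alpha> 0 = 0"

definition class_KL :: "(real \<Rightarrow> real \<Rightarrow> real) \<Rightarrow> bool" where
  "class_KL \<beta> \<longleftrightarrow>
     (\<forall>s\<ge>0. class_K (\<lambda>r. \<beta> r s)) \<and>
     (\<forall>r\<ge>0. antimono_on {0..} (\<beta> r) \<and> (\<beta> r \<longlongrightarrow> 0) at_top)"

(* The comparison function is chosen after the initial condition. *)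
definition GUAS :: "(nat \<Rightarrow> real^'n^'n) \<Rightarrow> (nat \<Rightarrow> nat) \<Rightarrow> bool" where
  "GUAS A \<sigma> \<longleftrightarrow>
     (\<forall>x0. \<exists>\<beta>. class_KL \<beta> \<and> (\<forall>k. norm (solution A \<sigma> x0 k) \<le> \<beta> (norm x0) (real k)))"

definition switching_times :: "(nat \<Rightarrow> nat) \<Rightarrow> nat set" where
  "switching_times \<sigma> = insert 0 {k. k \<ge> 1 \<and> \<sigma> k \<noteq> \<sigma> (k - 1)}"

(* "enumerate S n" is the n-th smallest element of an infinite set S, counting from 0, so
   enumerate (switching_times \<sigma>) is the switching sequence k_0 = 0 < k_1 < k_2 < ... of \<sigma>.
   Since this sequence is indexed by all natural numbers and its gaps are bounded,
   every admissible signal switches infinitely often. *)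
definition dwell_signals :: "nat \<Rightarrow> nat \<Rightarrow> nat \<Rightarrow> (nat \<Rightarrow> nat) set" where
  "dwell_signals N \<tau>min \<tau>max =
     {\<sigma>. range \<sigma> \<subseteq> {1..N} \<and> infinite (switching_times \<sigma>) \<and>
         (\<forall>n. enumerate (switching_times \<sigma>) (Suc n) - enumerate (switching_times \<sigma>) n
                \<in> {\<tau>min..\<tau>max})}"

definition index_sequences :: "nat \<Rightarrow> nat \<Rightarrow> (nat \<Rightarrow> nat) set" where
  "index_sequences N L = {i \<in> {1..L} \<rightarrow>\<^sub>E {1..N}. \<forall>l\<in>{1..<L}. i l \<noteq> i (Suc l)}"

definition switching_cycles :: "nat \<Rightarrow> nat \<Rightarrow> nat \<Rightarrow> nat \<Rightarrow> ((nat \<Rightarrow> nat) \<times> (nat \<Rightarrow> nat)) set" where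
  "switching_cycles N \<tau>min \<tau>max L = index_sequences N L \<times> ({1..L} \<rightarrow>\<^sub>E {\<tau>min..\<tau>max})"

primrec cycle_matrix :: "(nat \<Rightarrow> real^'n^'n) \<Rightarrow> (nat \<Rightarrow> nat) \<Rightarrow> (nat \<Rightarrow> nat) \<Rightarrow> nat \<Rightarrow> real^'n^'n" where
  "cycle_matrix A i \<tau> 0 = mat 1"
| "cycle_matrix A i \<tau> (Suc l) = matpow (A (i (Suc l))) (\<tau> (Suc l)) ** cycle_matrix A i \<tau> l"

lemma finite_index_sequences: "finite (index_sequences N L)"
  unfolding index_sequences_def by (rule finite_subset[of _ "{1..L} \<rightarrow>\<^sub>E {1..N}"]) (auto intro!: finite_PiE)

lemma card_index_sequences:
  assumes "L \<ge> 1"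
  shows "card (index_sequences N L) = N * (N - 1) ^ (L - 1)"
  using assms
proof (induction L rule: nat_induct_at_least)
  case base
  have "index_sequences N 1 = {1..1} \<rightarrow>\<^sub>E {1..N}"
    by (auto simp: index_sequences_def)
  then show ?case
    by (simp add: card_funcsetE)
next
  case (Suc L)
  let ?D = "SIGMA f:index_sequences N L. {1..N} - {f L}"
  let ?g = "\<lambda>(f, y). f(Suc L := y) :: nat \<Rightarrow> nat"
  have ins: "{1..Suc L} = insert (Suc L) {1..L}"
    by auto
  have inj: "inj_on ?g ?D"
  proof (rule inj_onI)
    fix p p' assume pp: "p \<in> ?D" "p' \<in> ?D" "?g p = ?g p'"
    obtain f y f' y' where p: "p = (f, y)" "p' = (f', y')"
      by (metis surj_pair)
    have f: "f \<in> index_sequences N L" "f' \<in> index_sequences N L"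
      and eq: "f(Suc L := y) = f'(Suc L := y')"
      using pp p by auto
    have "f (Suc L) = undefined" "f' (Suc L) = undefined"
      using f by (auto simp: index_sequences_def PiE_def extensional_def)
    then have "f = f' \<and> y = y'"
      using eq by (metis fun_upd_same fun_upd_triv fun_upd_upd)
    then show "p = p'"
      using p by simp
  qed
  have "index_sequences N (Suc L) = ?g ` ?D"
  proof
    show "?g ` ?D \<subseteq> index_sequences N (Suc L)"
      using Suc.hyps
      by (auto simp: index_sequences_def ins PiE_iff extensional_def less_Suc_eq)
    show "index_sequences N (Suc L) \<subseteq> ?g ` ?D"
    proof
      fix f assume f: "f \<in> index_sequences N (Suc L)"
      define f' where "f' = f(Suc L := undefined)"
      have "(f', f (Suc L)) \<in> ?D"
        using f Suc.hyps
        by (force simp: f'_def index_sequences_def PiE_iff extensional_def)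
      moreover have "f = ?g (f', f (Suc L))"
        by (simp add: f'_def)
      ultimately show "f \<in> ?g ` ?D"
        by blast
    qed
  qed
  then have "card (index_sequences N (Suc L)) = card ?D"
    using inj by (simp add: card_image)
  also have "\<dots> = (\<Sum>f\<in>index_sequences N L. card ({1..N} - {f L}))"
    by (simp add: finite_index_sequences)
  also have "\<dots> = (\<Sum>f\<in>index_sequences N L. N - 1)"
  proof (rule sum.cong)
    fix f assume "f \<in> index_sequences N L"
    then have "f L \<in> {1..N}"
      using Suc.hyps by (auto simp: index_sequences_def PiE_iff)
    then show "card ({1..N} - {f L}) = N - 1"
      by (simp add: card_Diff_singleton)
  qed simp
  also have "\<dots> = N * (N - 1) ^ (L - 1) * (N - 1)"
    using Suc.IH by simp
  also have "\<dots> = N * (N - 1) ^ (Suc L - 1)"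
    using Suc.hyps by (cases L) auto
  finally show ?case .
qed

lemma ex_enumeration_switching_cycles:
  assumes "L \<ge> 1" "\<tau>min \<le> \<tau>max" "d = \<tau>max - \<tau>min + 1"
  shows "\<exists>i \<tau>. bij_betw (\<lambda>h. (i h, \<tau> h)) {1..N * (N - 1) ^ (L - 1) * d ^ L}
                 (switching_cycles N \<tau>min \<tau>max L)"
proof -
  have "card (switching_cycles N \<tau>min \<tau>max L) = N * (N - 1) ^ (L - 1) * d ^ L"
    using assms
    by (simp add: switching_cycles_def card_cartesian_product card_index_sequences card_funcsetE
        Suc_diff_le)
  moreover have "finite (switching_cycles N \<tau>min \<tau>max L)"
    by (auto simp: switching_cycles_def finite_index_sequences intro!: finite_PiE)
  ultimately obtain c where
    "bij_betw c {1..N * (N - 1) ^ (L - 1) * d ^ L} (switching_cycles N \<tau>min \<tau>max L)"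
    by (metis ex_bij_betw_nat_finite_1)
  then have "bij_betw (\<lambda>h. ((fst \<circ> c) h, (snd \<circ> c) h)) {1..N * (N - 1) ^ (L - 1) * d ^ L}
               (switching_cycles N \<tau>min \<tau>max L)"
    by simp
  then show ?thesis by blast
qed

end

theory Submission
  imports Defs
begin

text \<open>
The three conditions are proved equivalent in a circle: (a) implies (b), (b) implies stability, and
stability implies (a).

A signal is cut at its switching times into blocks, each a mode together with its dwell time. An
admissible signal is then an infinite word over a finite alphabet of blocks in which neighbouring
blocks have different modes, an \<open>L\<close>-cycle is such a word of length \<open>L\<close>, and the state at the
switching times is the orbit of the initial state under the linear maps of the blocks
(\<open>solution_at_block_end\<close>). For a single signal, stability means only that every solution tends to
\<open>0\<close>, because the comparison function may depend on the initial state (\<open>GUAS_imp_tendsto\<close>,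
\<open>tendsto_imp_GUAS\<close>).

From (a) to (b), the final matrices \<open>P\<^sub>h(T\<^sub>h)\<close> are the certificate: along a cycle the quadratic forms
do not increase (\<open>stepwise_descent\<close>), so \<open>\<Phi>\<^sub>h\<^sup>T P\<^sub>h(T\<^sub>h) \<Phi>\<^sub>h\<close> is at most \<open>P\<^sub>h(0)\<close>, which lies
strictly below every \<open>P\<^sub>q(T\<^sub>q)\<close>.

From (b) to stability, cut the word of a signal into consecutive \<open>L\<close>-cycles. Comparing each cycle
with its predecessor, the value of the Lyapunov form at the state \<open>y\<close> drops by at least
\<open>\<mu> |y|\<^sup>2\<close>, with one \<open>\<mu> > 0\<close> for all of the finitely many pairs of cycles. The squared norms at
the cycle ends are therefore summable (\<open>switched_lyapunov_tendsto_0\<close>), and between the cycle ends the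
state grows by a bounded factor at most.

From stability to (a), the point is that convergence of each single solution is automatically
uniform (\<open>uniform_contraction\<close>). If states of norm \<open>1\<close> could keep norm at least \<open>1/2\<close> for arbitrarily
long words, then compactness of the unit sphere would give one state that can do so for all lengths,
and finiteness of the alphabet would turn this into one infinite word whose orbit does not
converge to \<open>0\<close>. Hence for some \<open>L\<close> every \<open>L\<close>-cycle at least halves the norm. Given such an \<open>L\<close>, solve
\<open>P(k) = A\<^sup>T P(k+1) A + \<epsilon> I\<close> backwards along each cycle from the final value \<open>I\<close>. The decrease along
the cycle holds by construction, and \<open>P(0)\<close> exceeds \<open>\<Phi>\<^sup>T \<Phi>\<close>, which is at most \<open>I/4\<close>, by
\<open>\<epsilon>\<close> times a matrix bounded uniformly over the cycles, so that it lies below \<open>I\<close> once \<open>\<epsilon>\<close> is small.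

For \<open>N = 1\<close> no signal switches infinitely often, so stability holds vacuously; the same argument then
yields an \<open>L\<close> for which there are no \<open>L\<close>-cycles.
\<close>

section \<open>Switched sequences of maps\<close>

primrec orbit :: "('s \<Rightarrow> 'a \<Rightarrow> 'a) \<Rightarrow> (nat \<Rightarrow> 's) \<Rightarrow> 'a \<Rightarrow> nat \<Rightarrow> 'a" where
  "orbit f w x 0 = x"
| "orbit f w x (Suc n) = f (w n) (orbit f w x n)"

lemma orbit_add: "orbit f w x (m + n) = orbit f (\<lambda>k. w (m + k)) (orbit f w x m) n"
  by (induction n) auto

lemma orbit_Suc_shift: "orbit f w x (Suc n) = orbit f (\<lambda>k. w (Suc k)) (f (w 0) x) n"
  using orbit_add[of f w x 1 n] by simp

lemma orbit_cong:
  assumes "\<And>k. k < n \<Longrightarrow> w k = w' k"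
  shows "orbit f w x n = orbit f w' x n"
  using assms by (induction n) auto

lemma orbit_scaleR:
  assumes "\<And>k. k < n \<Longrightarrow> linear (f (w k))"
  shows "orbit f w (c *\<^sub>R x) n = c *\<^sub>R orbit f w x n"
  using assms by (induction n) (auto simp: linear_cmul)

lemma norm_orbit_le:
  fixes f :: "'s \<Rightarrow> 'a::real_normed_vector \<Rightarrow> 'a"
  assumes "\<And>s x. s \<in> S \<Longrightarrow> norm (f s x) \<le> K * norm x" "K \<ge> 0" "\<And>k. k < n \<Longrightarrow> w k \<in> S"
  shows "norm (orbit f w x n) \<le> K ^ n * norm x"
  using assms(3)
proof (induction n)
  case (Suc n)
  have "norm (orbit f w x (Suc n)) \<le> K * norm (orbit f w x n)"
    using assms(1) Suc.prems by simp
  also have "\<dots> \<le> K * (K ^ n * norm x)"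
    using Suc assms(2) by (intro mult_left_mono) auto
  finally show ?case by (simp add: mult.assoc)
qed simp

lemma finite_linear_common_bound:
  fixes f :: "'s \<Rightarrow> 'a::euclidean_space \<Rightarrow> 'b::euclidean_space"
  assumes "finite S" "\<And>s. s \<in> S \<Longrightarrow> linear (f s)"
  obtains K where "K \<ge> 1" "\<And>s x. s \<in> S \<Longrightarrow> norm (f s x) \<le> K * norm x"
proof
  let ?K = "1 + (\<Sum>s\<in>S. onorm (f s))"
  have nonneg: "onorm (f s) \<ge> 0" if "s \<in> S" for s
    using assms(2)[OF that] by (simp add: linear_conv_bounded_linear onorm_pos_le)
  show "?K \<ge> 1"
    using nonneg by (simp add: sum_nonneg)
  show "norm (f s x) \<le> ?K * norm x" if "s \<in> S" for s x
  proof -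
    have "norm (f s x) \<le> onorm (f s) * norm x"
      using assms(2)[OF that] by (simp add: linear_conv_bounded_linear onorm)
    also have "onorm (f s) \<le> ?K"
      using member_le_sum[of s S "\<lambda>s. onorm (f s)"] nonneg assms(1) that by auto
    finally show ?thesis by (simp add: mult_right_mono)
  qed
qed

section \<open>Pointwise convergence along all words is uniform\<close>

text \<open>States that can keep norm at least \<open>1/2\<close> while the first \<open>n\<close> letters of some word starting with \<open>s\<close>
are applied. The letter \<open>s\<close> is still to be applied, which is what the constraint \<open>R\<close> on the next letter
refers to. The recursion on \<open>n\<close> builds the set from finite unions of preimages under continuous maps, so that it is closed.\<close>
primrec surviving :: "('s \<Rightarrow> 'a::real_normed_vector \<Rightarrow> 'a) \<Rightarrow> 's set \<Rightarrow> ('s \<Rightarrow> 's \<Rightarrow> bool) \<Rightarrow> nat \<Rightarrow> 's \<Rightarrow> 'a set"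
  where
  "surviving f S R 0 s = {x. 1/2 \<le> norm x}"
| "surviving f S R (Suc n) s =
     {x. 1/2 \<le> norm x} \<inter> (\<Union>t\<in>{t \<in> S. R s t}. f s -` surviving f S R n t)"

definition admissible_word :: "'s set \<Rightarrow> ('s \<Rightarrow> 's \<Rightarrow> bool) \<Rightarrow> nat \<Rightarrow> (nat \<Rightarrow> 's) \<Rightarrow> bool" where
  "admissible_word S R n w \<longleftrightarrow> (\<forall>k<n. w k \<in> S) \<and> (\<forall>k. Suc k < n \<longrightarrow> R (w k) (w (Suc k)))"

lemma admissible_word_shift: "admissible_word S R (m + n) w \<Longrightarrow> admissible_word S R n (\<lambda>k. w (m + k))"
  by (auto simp: admissible_word_def)

lemma admissible_word_prefix: "admissible_word S R n w \<Longrightarrow> m \<le> n \<Longrightarrow> admissible_word S R m w"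
  by (auto simp: admissible_word_def)

lemma closed_surviving:
  fixes f :: "'s \<Rightarrow> 'a::euclidean_space \<Rightarrow> 'a"
  assumes "finite S" "\<And>s. s \<in> S \<Longrightarrow> linear (f s)" "s \<in> S"
  shows "closed (surviving f S R n s)"
  using assms(3)
proof (induction n arbitrary: s)
  case 0
  show ?case by (auto intro!: closed_Collect_le continuous_intros)
next
  case (Suc n)
  have "closed (f s -` surviving f S R n t)" if "t \<in> S" for t
    using Suc that assms(2) by (intro closed_vimage linear_continuous_on) (auto simp: linear_conv_bounded_linear)
  then have "closed (\<Union>t\<in>{t \<in> S. R s t}. f s -` surviving f S R n t)"
    using assms(1) by (intro closed_UN) auto
  moreover have "closed {x::'a. 1/2 \<le> norm x}"
    by (intro closed_Collect_le continuous_intros)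
  ultimately show ?case by (simp add: closed_Int)
qed

lemma surviving_antimono: "m \<le> n \<Longrightarrow> surviving f S R n s \<subseteq> surviving f S R m s"
proof (rule lift_Suc_antimono_le[of "\<lambda>n. surviving f S R n s"])
  show "surviving f S R (Suc n) s \<subseteq> surviving f S R n s" for n
    by (induction n arbitrary: s) fastforce+
qed

lemma word_in_surviving:
  assumes "admissible_word S R (Suc n) w" "\<And>k. k \<le> n \<Longrightarrow> 1/2 \<le> norm (orbit f w x k)"
  shows "x \<in> surviving f S R n (w 0)"
  using assms
proof (induction n arbitrary: w x)
  case 0
  then show ?case using 0(2)[of 0] by simp
next
  case (Suc n)
  have "f (w 0) x \<in> surviving f S R n (w 1)"
    using Suc.IH[of "\<lambda>k. w (Suc k)" "f (w 0) x"] admissible_word_shift[of S R 1 "Suc n" w] Suc.prems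
    by (force simp flip: orbit_Suc_shift)
  moreover have "w 1 \<in> S" "R (w 0) (w 1)"
    using Suc.prems(1) by (auto simp: admissible_word_def)
  ultimately show ?case using Suc.prems(2)[of 0] by auto
qed

text \<open>Pigeonhole in the form needed for an infinite descent: if every \<open>t\<close> failed at some stage, then all
of them would fail at the maximum of these stages.\<close>
lemma finite_antimono_choice:
  fixes Q :: "nat \<Rightarrow> 's \<Rightarrow> bool"
  assumes "finite S" "\<And>n. \<exists>t\<in>S. Q n t" "\<And>m n t. m \<le> n \<Longrightarrow> Q n t \<Longrightarrow> Q m t"
  shows "\<exists>t\<in>S. \<forall>n. Q n t"
proof (rule ccontr)
  assume "\<not> ?thesis"
  then obtain g where g: "\<And>t. t \<in> S \<Longrightarrow> \<not> Q (g t) t" by metis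
  obtain t where t: "t \<in> S" "Q (Max (g ` S)) t"
    using assms(2) by blast
  then have "Q (g t) t"
    using assms(1) by (intro assms(3)[OF _ t(2)]) auto
  then show False using g t by blast
qed

text \<open>The word is built letter by letter. Having survived all lengths is inherited by a suitable successor:
each length admits a next letter, and since the conditions get stronger with the length, one of the
finitely many letters works for all lengths at once.\<close>
lemma ex_surviving_infinite_word:
  fixes f :: "'s \<Rightarrow> 'a::euclidean_space \<Rightarrow> 'a"
  assumes S: "finite S" and x: "\<And>n. x \<in> surviving f S R n s" and s: "s \<in> S"
  obtains w where "\<And>n. w n \<in> S" "\<And>n. R (w n) (w (Suc n))" "\<And>n. 1/2 \<le> norm (orbit f w x n)"
proof -
  let ?Q = "\<lambda>p. fst p \<in> S \<and> (\<forall>n. snd p \<in> surviving f S R n (fst p))"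
  let ?step = "\<lambda>p q. R (fst p) (fst q) \<and> snd q = f (fst p) (snd p)"
  have "\<exists>p. \<forall>n. (?Q (p n) \<and> (n = 0 \<longrightarrow> p n = (s, x))) \<and> ?step (p n) (p (Suc n))"
  proof (rule dependent_nat_choice[where P = "\<lambda>n p. ?Q p \<and> (n = 0 \<longrightarrow> p = (s, x))" and Q = "\<lambda>n. ?step"])
    show "\<exists>p. ?Q p \<and> (0 = (0::nat) \<longrightarrow> p = (s, x))"
      using x s by auto
  next
    fix p and n :: nat assume p: "?Q p \<and> (n = 0 \<longrightarrow> p = (s, x))"
    then have mem: "snd p \<in> surviving f S R m (fst p)" for m
      by blast
    have "\<exists>t\<in>{t\<in>S. R (fst p) t}. \<forall>m. f (fst p) (snd p) \<in> surviving f S R m t"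
    proof (rule finite_antimono_choice)
      show "\<exists>t\<in>{t\<in>S. R (fst p) t}. f (fst p) (snd p) \<in> surviving f S R m t" for m
        using mem[of "Suc m"] by simp
      show "f (fst p) (snd p) \<in> surviving f S R k t"
        if "k \<le> m" "f (fst p) (snd p) \<in> surviving f S R m t" for k m t
        using surviving_antimono[OF that(1), of f S R t] that(2) by blast
    qed (use S in simp)
    then obtain t where "t \<in> S" "R (fst p) t" "\<And>m. f (fst p) (snd p) \<in> surviving f S R m t"
      by blast
    then show "\<exists>q. (?Q q \<and> (Suc n = 0 \<longrightarrow> q = (s, x))) \<and> ?step p q"
      by (intro exI[of _ "(t, f (fst p) (snd p))"]) simp
  qed
  then obtain p where p: "\<And>n. ?Q (p n)" "p 0 = (s, x)" "\<And>n. ?step (p n) (p (Suc n))"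
    by blast
  define w where "w = fst \<circ> p"
  have "orbit f w x n = snd (p n)" for n
    using p(2,3) by (induction n) (auto simp: w_def)
  moreover have "1/2 \<le> norm (snd (p n))" for n
    using p(1)[of n, THEN conjunct2, rule_format, of 0] by simp
  ultimately show thesis
    using p by (intro that[of w]) (auto simp: w_def)
qed

text \<open>Compactness of the unit sphere: if states survived for every length, then the closed decreasing sets of
survivors would have a common point, whose infinite word contradicts convergence. By linearity it is
enough to look at the unit sphere.\<close>
lemma uniform_halving_time:
  fixes f :: "'s \<Rightarrow> 'a::euclidean_space \<Rightarrow> 'a"
  assumes S: "finite S" and lin: "\<And>s. s \<in> S \<Longrightarrow> linear (f s)"
    and conv: "\<And>w x. (\<And>n. w n \<in> S) \<Longrightarrow> (\<And>n. R (w n) (w (Suc n))) \<Longrightarrow> orbit f w x \<longlonglongrightarrow> 0"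
  shows "\<exists>n. \<forall>w x. admissible_word S R (Suc n) w \<longrightarrow> x \<noteq> 0 \<longrightarrow> (\<exists>k\<le>n. norm (orbit f w x k) < norm x / 2)"
proof -
  have "\<exists>n. \<forall>s\<in>S. sphere 0 1 \<inter> surviving f S R n s = {}"
  proof (rule ccontr)
    assume "\<not> ?thesis"
    then have "\<exists>s\<in>S. \<forall>n. sphere 0 1 \<inter> surviving f S R n s \<noteq> {}"
      using surviving_antimono[of _ _ f S R] by (intro finite_antimono_choice S) blast+
    then obtain s where s: "s \<in> S" "\<And>n. sphere 0 1 \<inter> surviving f S R n s \<noteq> {}" by blast
    have "(\<Inter>n. sphere 0 1 \<inter> surviving f S R n s) \<noteq> {}"
    proof (rule compact_nest)
      show "compact (sphere 0 1 \<inter> surviving f S R n s)" for n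
        using closed_surviving[OF S lin] s(1) by (simp add: compact_Int_closed)
      show "sphere 0 1 \<inter> surviving f S R n s \<subseteq> sphere 0 1 \<inter> surviving f S R m s" if "m \<le> n" for m n
        using surviving_antimono[OF that, of f S R s] by blast
    qed (use s in blast)
    then obtain x where "\<And>n. x \<in> surviving f S R n s" by blast
    from ex_surviving_infinite_word[OF S this s(1)]
    obtain w where w: "\<And>n. w n \<in> S" "\<And>n. R (w n) (w (Suc n))" "\<And>n. 1/2 \<le> norm (orbit f w x n)"
      by blast
    from conv[of w x] w have "(\<lambda>n. norm (orbit f w x n)) \<longlonglongrightarrow> 0"
      by (auto intro: tendsto_norm_zero)
    then have "1/2 \<le> (0::real)"
      by (rule LIMSEQ_le_const) (use w(3) in auto)
    then show False by simp
  qed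
  then obtain n where n: "\<And>s. s \<in> S \<Longrightarrow> sphere 0 1 \<inter> surviving f S R n s = {}" by blast
  show ?thesis
  proof (rule exI[of _ n], intro allI impI)
    fix w x assume w: "admissible_word S R (Suc n) w" and x: "x \<noteq> (0::'a)"
    show "\<exists>k\<le>n. norm (orbit f w x k) < norm x / 2"
    proof (rule ccontr)
      assume "\<not> ?thesis"
      then have ge: "norm x / 2 \<le> norm (orbit f w x k)" if "k \<le> n" for k
        using that by force
      let ?u = "(1 / norm x) *\<^sub>R x"
      have "1/2 \<le> norm (orbit f w ?u k)" if "k \<le> n" for k
      proof -
        have "orbit f w ?u k = (1 / norm x) *\<^sub>R orbit f w x k"
          using w that by (intro orbit_scaleR lin) (auto simp: admissible_word_def)
        then show ?thesis using ge[OF that] x by (simp add: field_simps)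
      qed
      then have "?u \<in> surviving f S R n (w 0)"
        by (rule word_in_surviving[OF w])
      moreover have "w 0 \<in> S" using w by (auto simp: admissible_word_def)
      moreover have "?u \<in> sphere 0 1" using x by simp
      ultimately show False using n[of "w 0"] by blast
    qed
  qed
qed

text \<open>Whenever the norm has dropped to a half, which takes at most \<open>n\<close> letters, the argument can be restarted
on the remaining word, because a suffix of an admissible word is admissible. This gives exponential
decay with a common rate, in which the factor \<open>C\<close> covers a last stretch of at most \<open>n\<close> letters.\<close>
lemma uniform_contraction:
  fixes f :: "'s \<Rightarrow> 'a::euclidean_space \<Rightarrow> 'a"
  assumes S: "finite S" and lin: "\<And>s. s \<in> S \<Longrightarrow> linear (f s)"
    and conv: "\<And>w x. (\<And>n. w n \<in> S) \<Longrightarrow> (\<And>n. R (w n) (w (Suc n))) \<Longrightarrow> orbit f w x \<longlonglongrightarrow> 0"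
  obtains L where "L \<ge> 1" "\<And>w x. admissible_word S R L w \<Longrightarrow> norm (orbit f w x L) \<le> norm x / 2"
proof -
  have "\<exists>n. \<forall>w x. admissible_word S R (Suc n) w \<longrightarrow> x \<noteq> 0 \<longrightarrow> (\<exists>k\<le>n. norm (orbit f w x k) < norm x / 2)"
    by (rule uniform_halving_time[OF S]) (fact lin conv)+
  then obtain n where n: "\<And>w x. admissible_word S R (Suc n) w \<Longrightarrow> x \<noteq> 0 \<Longrightarrow> \<exists>k\<le>n. norm (orbit f w x k) < norm x / 2"
    by blast
  obtain K where K: "K \<ge> 1" "\<And>s x. s \<in> S \<Longrightarrow> norm (f s x) \<le> K * norm x"
    using finite_linear_common_bound[OF S, of f] lin by blast
  define C where "C = K ^ n"
  have C: "C \<ge> 1" using K by (simp add: C_def)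
  have bound: "norm (orbit f w x m) \<le> C / 2 ^ (m div Suc n) * norm x" if "admissible_word S R m w" for m w x
    using that
  proof (induction m arbitrary: w x rule: less_induct)
    case (less m)
    show ?case
    proof (cases "m \<le> n \<or> x = 0")
      case True
      have le: "norm (orbit f w x m) \<le> K ^ m * norm x"
        using K less.prems by (intro norm_orbit_le[of S]) (auto simp: admissible_word_def)
      show ?thesis
      proof (cases "x = 0")
        case False
        then have "m \<le> n" using True by simp
        then have "K ^ m * norm x \<le> C * norm x"
          using K by (auto simp: C_def intro!: mult_right_mono power_increasing)
        then show ?thesis using le \<open>m \<le> n\<close> by simp
      qed (use le in simp)
    next
      case False
      then obtain k where k: "k \<le> n" "norm (orbit f w x k) < norm x / 2"
        using n[of w x] admissible_word_prefix[OF less.prems, of "Suc n"] by auto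
      then have k0: "k \<ge> 1" by (cases k) auto
      define r where "r = m - k"
      have m: "m = k + r" and "r < m"
        using k k0 False by (auto simp: r_def)
      \<comment> \<open>The prefix of length \<open>k\<close> uses up at most one of the quotas of \<open>Suc n\<close> letters.\<close>
      have "m div Suc n \<le> (r + Suc n) div Suc n"
        using m k by (intro div_le_mono) simp
      also have "\<dots> = r div Suc n + 1"
        by (rule div_add_self2) simp
      finally have r: "m div Suc n \<le> Suc (r div Suc n)" by simp
      have "norm (orbit f w x m) \<le> C / 2 ^ (r div Suc n) * norm (orbit f w x k)"
        unfolding m orbit_add using less.prems m by (intro less.IH \<open>r < m\<close> admissible_word_shift) simp
      also have "\<dots> \<le> C / 2 ^ (r div Suc n) * (norm x / 2)"
        using k C by (intro mult_left_mono) auto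
      also have "\<dots> = C / 2 ^ Suc (r div Suc n) * norm x" by simp
      also have "\<dots> \<le> C / 2 ^ (m div Suc n) * norm x"
        using r C by (intro mult_right_mono divide_left_mono power_increasing) auto
      finally show ?thesis .
    qed
  qed
  obtain p where p: "2 * C < 2 ^ p"
    using real_arch_pow[of 2 "2 * C"] by auto
  define L where "L = p * Suc n"
  show thesis
  proof
    have "p \<noteq> 0"
    proof
      assume "p = 0" then show False using p C by simp
    qed
    then show "L \<ge> 1" by (simp add: L_def)
    fix w x assume "admissible_word S R L w"
    moreover have "L div Suc n = p"
      unfolding L_def by (rule nonzero_mult_div_cancel_right) simp
    ultimately have "norm (orbit f w x L) \<le> C / 2 ^ p * norm x"
      using bound[of L w x] by simp
    also have "\<dots> \<le> 1 / 2 * norm x"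
      using p by (intro mult_right_mono) (auto simp: field_simps)
    finally show "norm (orbit f w x L) \<le> norm x / 2" by simp
  qed
qed

section \<open>Signals as sequences of blocks\<close>

lemma solution_eq_orbit: "solution A \<sigma> x k = orbit (\<lambda>j. (*v) (A j)) \<sigma> x k"
  by (induction k) auto

text \<open>A block is a pair of a mode and its dwell time.\<close>
definition dwell_map :: "(nat \<Rightarrow> real^'n^'n) \<Rightarrow> nat \<times> nat \<Rightarrow> real^'n \<Rightarrow> real^'n" where
  "dwell_map A b = (*v) (matpow (A (fst b)) (snd b))"

lemma linear_dwell_map: "linear (dwell_map A b)"
  by (simp add: dwell_map_def)

lemma cycle_matrix_eq_orbit:
  "cycle_matrix A i \<tau> l *v x = orbit (dwell_map A) (\<lambda>j. (i (Suc j), \<tau> (Suc j))) x l"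
  by (induction l) (auto simp: dwell_map_def simp flip: matrix_vector_mul_assoc)

lemma solution_constant_block:
  assumes "\<And>k. m \<le> k \<Longrightarrow> k < m + r \<Longrightarrow> \<sigma> k = j"
  shows "solution A \<sigma> x (m + r) = matpow (A j) r *v solution A \<sigma> x m"
  using assms by (induction r) (auto simp flip: matrix_vector_mul_assoc)

lemma solution_at_block_end:
  assumes "\<And>l k. l < n \<Longrightarrow> (\<Sum>j<l. \<tau> j) \<le> k \<Longrightarrow> k < (\<Sum>j<Suc l. \<tau> j) \<Longrightarrow> \<sigma> k = i l"
  shows "solution A \<sigma> x (\<Sum>j<n. \<tau> j) = orbit (dwell_map A) (\<lambda>l. (i l, \<tau> l)) x n"
  using assms
proof (induction n)
  case (Suc n)
  have "solution A \<sigma> x ((\<Sum>j<n. \<tau> j) + \<tau> n) = matpow (A (i n)) (\<tau> n) *v solution A \<sigma> x (\<Sum>j<n. \<tau> j)"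
    using Suc.prems by (intro solution_constant_block) auto
  then show ?case using Suc by (simp add: dwell_map_def)
qed simp

text \<open>For a sequence \<open>\<tau>\<close> of dwell times, the index of the block in progress at time \<open>k\<close>. Only the dwell times
up to time \<open>k\<close> matter, so the same definition serves infinite signals and finite cycles.\<close>
definition active_block :: "(nat \<Rightarrow> nat) \<Rightarrow> nat \<Rightarrow> nat" where
  "active_block \<tau> k = (LEAST l. k < (\<Sum>j<Suc l. \<tau> j))"

lemma active_block_eq:
  assumes "(\<Sum>j<l. \<tau> j) \<le> k" "k < (\<Sum>j<Suc l. \<tau> j)"
  shows "active_block \<tau> k = l"
  unfolding active_block_def
proof (rule Least_equality)
  fix l' assume l': "k < (\<Sum>j<Suc l'. \<tau> j)"
  show "l \<le> l'"
  proof (rule ccontr)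
    assume "\<not> l \<le> l'"
    then have "(\<Sum>j<Suc l'. \<tau> j) \<le> (\<Sum>j<l. \<tau> j)" by (intro sum_mono2) auto
    then show False using l' assms(1) by simp
  qed
qed (fact assms(2))

lemma ex_bracketing_index:
  fixes s :: "nat \<Rightarrow> 'a::linorder"
  assumes "s 0 \<le> k" "k < s n"
  obtains l where "l < n" "s l \<le> k" "k < s (Suc l)"
proof -
  have "\<exists>l<n. s l \<le> k \<and> k < s (Suc l)"
    using assms(2)
  proof (induction n)
    case (Suc n)
    then show ?case
      by (cases "k < s n") (auto simp: less_Suc_eq)
  qed (use assms(1) in simp)
  then show thesis using that by blast
qed

lemma enumerate_range_strict_mono:
  fixes t :: "nat \<Rightarrow> nat"
  assumes "strict_mono t"
  shows "enumerate (range t) n = t n"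
proof (induction n)
  case 0
  show ?case unfolding enumerate_0
    by (rule Least_equality) (use assms in \<open>auto simp: strict_mono_less_eq\<close>)
next
  case (Suc n)
  have "infinite (range t)"
    using assms strict_mono_imp_increasing range_inj_infinite strict_mono_on_imp_inj_on by blast
  then have "enumerate (range t) (Suc n) = (LEAST s. s \<in> range t \<and> t n < s)"
    using Suc by (simp add: enumerate_Suc'')
  also have "\<dots> = t (Suc n)"
    by (rule Least_equality) (use assms in \<open>auto simp: strict_mono_less strict_mono_less_eq\<close>)
  finally show ?case .
qed

lemma strict_mono_block_ends:
  fixes \<tau> :: "nat \<Rightarrow> nat"
  assumes "\<And>l. 1 \<le> \<tau> l"
  shows "strict_mono (\<lambda>n. \<Sum>j<n. \<tau> j)"
  by (rule strict_monoI_Suc) (use assms in \<open>simp add: Suc_le_eq\<close>)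

text \<open>Modes that differ from block to block make the block boundaries exactly the discontinuities; without
this, two blocks could merge into one that is too long.\<close>
lemma block_signal_in_dwell_signals:
  assumes i: "\<And>l. i l \<in> {1..N}" "\<And>l. i l \<noteq> i (Suc l)"
    and \<tau>: "\<And>l. \<tau> l \<in> {\<tau>min..\<tau>max}" "1 \<le> \<tau>min"
  shows "(\<lambda>k. i (active_block \<tau> k)) \<in> dwell_signals N \<tau>min \<tau>max"
proof -
  let ?\<sigma> = "\<lambda>k. i (active_block \<tau> k)"
  define t where "t n = (\<Sum>j<n. \<tau> j)" for n
  have t0: "t 0 = 0" and tS: "t (Suc n) = t n + \<tau> n" for n by (auto simp: t_def)
  have pos: "1 \<le> \<tau> l" for l using \<tau> order_trans by fastforce
  have mono: "strict_mono t"
    unfolding t_def using pos by (rule strict_mono_block_ends)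
  have act: "active_block \<tau> k = l" if "t l \<le> k" "k < t (Suc l)" for k l
    using that unfolding t_def by (rule active_block_eq)
  have "switching_times ?\<sigma> = range t"
  proof (intro equalityI subsetI)
    fix k assume k: "k \<in> switching_times ?\<sigma>"
    have "k < t (Suc k)"
      using strict_mono_imp_increasing[OF mono, of "Suc k"] by simp
    then obtain l where l: "t l \<le> k" "k < t (Suc l)"
      using ex_bracketing_index[of t k "Suc k"] t0 by auto
    have "t l = k"
    proof (rule ccontr)
      assume "t l \<noteq> k"
      then have "t l \<le> k - 1" "k - 1 < t (Suc l)" "k \<noteq> 0" using l by auto
      then show False using act[of l k] act[of l "k - 1"] l k by (auto simp: switching_times_def)
    qed
    then show "k \<in> range t" by blast
  next
    fix k assume "k \<in> range t"
    then obtain l where l: "k = t l" by blast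
    show "k \<in> switching_times ?\<sigma>"
    proof (cases l)
      case 0
      then show ?thesis using l t0 by (simp add: switching_times_def)
    next
      case (Suc l')
      have "active_block \<tau> k = l"
        using l tS[of l] pos[of l] by (intro act) auto
      moreover have "active_block \<tau> (k - 1) = l'"
        using l Suc tS[of l'] pos[of l'] by (intro act) auto
      moreover have "k \<ge> 1"
        using l Suc tS[of l'] pos[of l'] by simp
      ultimately show ?thesis
        using i(2)[of l'] Suc by (simp add: switching_times_def)
    qed
  qed
  moreover have "infinite (range t)"
    using mono range_inj_infinite strict_mono_on_imp_inj_on by blast
  ultimately show ?thesis
    using i(1) \<tau>(1) by (auto simp: dwell_signals_def enumerate_range_strict_mono[OF mono] tS)
qed

text \<open>Conversely, an admissible signal is constant between consecutive switching times, which gives its modes and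
dwell times.\<close>
lemma signal_blocks:
  assumes \<sigma>: "\<sigma> \<in> dwell_signals N \<tau>min \<tau>max"
  obtains i \<tau> where "\<And>l. i l \<in> {1..N}" "\<And>l. i l \<noteq> i (Suc l)" "\<And>l. \<tau> l \<in> {\<tau>min..\<tau>max}"
    "\<And>l. 1 \<le> \<tau> l"
    "\<And>l k. (\<Sum>j<l. \<tau> j) \<le> k \<Longrightarrow> k < (\<Sum>j<Suc l. \<tau> j) \<Longrightarrow> \<sigma> k = i l"
proof -
  let ?S = "switching_times \<sigma>"
  define t where "t = enumerate ?S"
  define \<tau> where "\<tau> l = t (Suc l) - t l" for l
  have inf: "infinite ?S" and \<tau>: "\<tau> l \<in> {\<tau>min..\<tau>max}" for l
    using \<sigma> by (auto simp: dwell_signals_def t_def \<tau>_def)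
  have mono: "t l < t (Suc l)" for l
    unfolding t_def using inf by (rule enumerate_step)
  have "t 0 = 0"
    unfolding t_def enumerate_0 by (rule Least_equality) (auto simp: switching_times_def)
  then have sum: "(\<Sum>j<l. \<tau> j) = t l" for l
    using mono[THEN less_imp_le] by (induction l) (auto simp: \<tau>_def)
  have const: "\<sigma> (t l + r) = \<sigma> (t l)" if "t l + r < t (Suc l)" for l r
    using that
  proof (induction r)
    case (Suc r)
    have "t l + Suc r \<notin> ?S"
    proof
      assume "t l + Suc r \<in> ?S"
      then have "enumerate ?S (Suc l) \<le> t l + Suc r"
        unfolding enumerate_Suc''[OF inf] by (intro Least_le) (auto simp: t_def)
      then show False using Suc.prems by (simp add: t_def)
    qed
    then show ?case using Suc by (simp add: switching_times_def)
  qed simp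
  have const': "\<sigma> k = \<sigma> (t l)" if "t l \<le> k" "k < t (Suc l)" for k l
    using const[of l "k - t l"] that by simp
  show thesis
  proof (rule that[of "\<lambda>l. \<sigma> (t l)" \<tau>])
    show "\<sigma> (t l) \<in> {1..N}" for l using \<sigma> by (auto simp: dwell_signals_def image_subset_iff)
    show "\<sigma> (t l) \<noteq> \<sigma> (t (Suc l))" for l
    proof -
      have "t (Suc l) \<in> ?S" unfolding t_def using inf by (rule enumerate_in_set)
      then have "\<sigma> (t (Suc l)) \<noteq> \<sigma> (t (Suc l) - 1)"
        using mono[of l] by (simp add: switching_times_def)
      moreover have "\<sigma> (t (Suc l) - 1) = \<sigma> (t l)"
        using mono[of l] by (intro const') auto
      ultimately show ?thesis by simp
    qed
    show "1 \<le> \<tau> l" for l using mono[of l] by (simp add: \<tau>_def)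
    show "\<sigma> k = \<sigma> (t l)" if "(\<Sum>j<l. \<tau> j) \<le> k" "k < (\<Sum>j<Suc l. \<tau> j)" for l k
      using const' that unfolding sum .
  qed (fact \<tau>)
qed

section \<open>Stability as convergence\<close>

lemma GUAS_imp_tendsto:
  assumes "GUAS A \<sigma>"
  shows "solution A \<sigma> x \<longlonglongrightarrow> 0"
proof -
  obtain \<beta> where \<beta>: "class_KL \<beta>" "\<And>k. norm (solution A \<sigma> x k) \<le> \<beta> (norm x) (real k)"
    using assms by (auto simp: GUAS_def)
  have "(\<beta> (norm x) \<longlongrightarrow> 0) at_top" using \<beta>(1) by (simp add: class_KL_def)
  then have "(\<lambda>k. \<beta> (norm x) (real k)) \<longlonglongrightarrow> 0"
    by (rule filterlim_compose[OF _ filterlim_real_sequentially])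
  then show ?thesis
    by (rule Lim_null_comparison[rotated]) (use \<beta> in simp)
qed

text \<open>The supremum of the tail of \<open>c\<close> from \<open>\<lfloor>s\<rfloor>\<close> on decreases to \<open>0\<close>; adding \<open>1/(1+s)\<close> makes it positive, as
strict monotonicity of a comparison function in its first argument demands.\<close>
lemma decreasing_majorant:
  fixes c :: "nat \<Rightarrow> real"
  assumes c: "c \<longlonglongrightarrow> 0" "\<And>k. 0 \<le> c k"
  obtains g where "\<And>k. c k \<le> g (real k)" "\<And>s. 0 \<le> s \<Longrightarrow> 0 < g s" "antimono_on {0..} g" "(g \<longlongrightarrow> 0) at_top"
proof -
  define C where "C n = (SUP k\<in>{n..}. c k)" for n
  have bdd: "bdd_above (c ` A)" for A
  proof -
    have "Bseq c" using c convergentI convergent_imp_Bseq by blast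
    then obtain K where "\<And>n. \<bar>c n\<bar> \<le> K" unfolding Bseq_def real_norm_def by blast
    then show ?thesis by (metis abs_le_D1 bdd_aboveI2)
  qed
  have up: "c k \<le> C n" if "n \<le> k" for n k
    unfolding C_def using that bdd by (intro cSUP_upper) auto
  have anti: "C n \<le> C m" if "m \<le> n" for m n
    unfolding C_def using that bdd by (intro cSUP_subset_mono) auto
  have nonneg: "0 \<le> C n" for n using up[of n n] c(2)[of n] by simp
  have C: "C \<longlonglongrightarrow> 0"
  proof (rule LIMSEQ_I)
    fix r :: real assume "0 < r"
    then obtain n where n: "\<And>k. n \<le> k \<Longrightarrow> c k < r/2"
      using c LIMSEQ_D[OF c(1), of "r/2"] by (auto simp: abs_less_iff)
    have "C m < r" if "n \<le> m" for m
    proof -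
      have "C m \<le> r/2" unfolding C_def using n that by (intro cSUP_least) (auto intro: less_imp_le)
      then show ?thesis using \<open>0 < r\<close> by simp
    qed
    then show "\<exists>n. \<forall>m\<ge>n. norm (C m - 0) < r" using nonneg by auto
  qed
  define g where "g s = C (nat \<lfloor>s\<rfloor>) + 1 / (1 + s)" for s
  show thesis
  proof (rule that[of g])
    show "c k \<le> g (real k)" for k
      using up[of k k] by (simp add: g_def add_increasing2)
    show "0 < g s" if "0 \<le> s" for s
      using nonneg that by (simp add: g_def add_nonneg_pos)
    show "antimono_on {0..} g"
      by (auto simp: monotone_on_def g_def intro!: add_mono anti nat_mono floor_mono divide_left_mono)
    have "filterlim (\<lambda>s::real. nat \<lfloor>s\<rfloor>) sequentially at_top"
      by (rule filterlim_compose[OF filterlim_nat_sequentially filterlim_floor_sequentially])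
    then have "((\<lambda>s::real. C (nat \<lfloor>s\<rfloor>)) \<longlongrightarrow> 0) at_top"
      by (rule filterlim_compose[OF C])
    moreover have "((\<lambda>s::real. 1 / (1 + s)) \<longlongrightarrow> 0) at_top"
      by (intro tendsto_divide_0[OF tendsto_const] filterlim_at_top_imp_at_infinity
          filterlim_tendsto_add_at_top[OF tendsto_const filterlim_ident])
    ultimately show "(g \<longlongrightarrow> 0) at_top"
      unfolding g_def using tendsto_add[of _ 0 at_top _ 0] by fastforce
  qed
qed

text \<open>With \<open>x0\<close> given, a comparison function that is linear in its first argument suffices.\<close>
lemma tendsto_imp_GUAS:
  fixes A :: "nat \<Rightarrow> real^'n^'n"
  assumes "\<And>x. solution A \<sigma> x \<longlonglongrightarrow> 0"
  shows "GUAS A \<sigma>"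
  unfolding GUAS_def
proof
  fix x0 :: "real^'n"
  define c where "c k = norm (solution A \<sigma> x0 k) / norm x0" for k
  have "c \<longlonglongrightarrow> 0"
    unfolding c_def using tendsto_divide_zero[OF tendsto_norm_zero[OF assms]] .
  moreover have "0 \<le> c k" for k by (simp add: c_def)
  ultimately obtain g where g: "\<And>k. c k \<le> g (real k)" "\<And>s. 0 \<le> s \<Longrightarrow> 0 < g s"
      "antimono_on {0..} g" "(g \<longlongrightarrow> 0) at_top"
    using decreasing_majorant by blast
  let ?\<beta> = "\<lambda>r s. r * g s"
  have "class_K (\<lambda>r. ?\<beta> r s)" if "0 \<le> s" for s
    unfolding class_K_def strict_mono_on_def using g(2)[OF that] by (auto intro!: continuous_on_mult_right)
  moreover have "antimono_on {0..} (?\<beta> r) \<and> (?\<beta> r \<longlongrightarrow> 0) at_top" if "0 \<le> r" for r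
    using that g(3) tendsto_mult_right_zero[OF g(4)]
    by (auto simp: monotone_on_def intro!: mult_left_mono)
  moreover have "norm (solution A \<sigma> x0 k) \<le> norm x0 * g (real k)" for k
  proof -
    have "norm (solution A \<sigma> x0 k) = norm x0 * c k"
    \<comment> \<open>Here \<open>c\<close> is \<open>0 / 0 = 0\<close>, and the solution is constantly \<open>0\<close>.\<close>
    proof (cases "x0 = 0")
      case True
      have "solution A \<sigma> 0 k = 0" by (induction k) auto
      then show ?thesis using True by simp
    qed (simp add: c_def)
    then show ?thesis using g(1) by (simp add: mult_left_mono)
  qed
  ultimately show "\<exists>\<beta>. class_KL \<beta> \<and> (\<forall>k. norm (solution A \<sigma> x0 k) \<le> \<beta> (norm x0) (real k))"
    by (intro exI[of _ ?\<beta>]) (simp add: class_KL_def)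
qed

section \<open>Quadratic forms\<close>

lemma inner_congruence:
  fixes B P :: "real^'n^'n"
  shows "x \<bullet> ((transpose B ** P ** B) *v x) = (B *v x) \<bullet> (P *v (B *v x))"
proof -
  have "x \<bullet> ((transpose B ** P ** B) *v x) = x \<bullet> (transpose B *v (P *v (B *v x)))"
    by (simp only: matrix_vector_mul_assoc matrix_mul_assoc)
  also have "\<dots> = (P *v (B *v x)) \<bullet> (B *v x)"
    by (simp add: inner_commute[of x] dot_lmul_matrix)
  finally show ?thesis by (simp add: inner_commute)
qed

lemma transpose_add: "transpose (X + Y) = transpose X + transpose (Y :: 'a::plus^'n^'m)"
  by (simp add: transpose_def vec_eq_iff)

lemma transpose_diff: "transpose (X - Y) = transpose X - transpose (Y :: 'a::minus^'n^'m)"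
  by (simp add: transpose_def vec_eq_iff)

lemma transpose_congruence:
  fixes B P :: "real^'n^'n"
  shows "transpose P = P \<Longrightarrow> transpose (transpose B ** P ** B) = transpose B ** P ** B"
  by (simp add: matrix_transpose_mul matrix_mul_assoc)

lemma diff_pd_less_0_iff:
  fixes X Y :: "real^'n^'n"
  assumes "transpose X = X" "transpose Y = Y"
  shows "X - Y \<prec>\<^sub>p\<^sub>d 0 \<longleftrightarrow> (\<forall>x. x \<noteq> 0 \<longrightarrow> x \<bullet> (X *v x) < x \<bullet> (Y *v x))"
  using assms
  by (simp add: pd_less_def pos_def_def transpose_diff matrix_vector_mult_diff_rdistrib inner_diff_right)

lemma pd_less_0_imp_inner_le:
  fixes X Y :: "real^'n^'n"
  assumes "X - Y \<prec>\<^sub>p\<^sub>d 0"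
  shows "x \<bullet> (X *v x) \<le> x \<bullet> (Y *v x)"
  using assms by (cases "x = 0")
    (auto simp: pd_less_def pos_def_def matrix_vector_mult_diff_rdistrib inner_diff_right intro: less_imp_le)

text \<open>The minimum of the quadratic form on the unit sphere, which is compact, serves as \<open>\<mu>\<close>.\<close>
lemma pos_def_lower_bound:
  fixes Z :: "real^'n^'n"
  assumes "pos_def Z"
  obtains \<mu> where "\<mu> > 0" "\<And>x. \<mu> * (norm x)\<^sup>2 \<le> x \<bullet> (Z *v x)"
proof -
  have "sphere (0::real^'n) 1 \<noteq> {}"
    by simp
  moreover have "continuous_on (sphere 0 1) (\<lambda>x. x \<bullet> (Z *v x))"
    by (intro continuous_intros linear_continuous_on matrix_vector_mul_bounded_linear)
  ultimately obtain u where u: "u \<in> sphere 0 1" "\<And>v. v \<in> sphere 0 1 \<Longrightarrow> u \<bullet> (Z *v u) \<le> v \<bullet> (Z *v v)"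
    using continuous_attains_inf[of "sphere 0 1" "\<lambda>x. x \<bullet> (Z *v x)"] by auto
  show thesis
  proof
    show "u \<bullet> (Z *v u) > 0"
      using u(1) assms unfolding pos_def_def by (metis dist_0_norm mem_sphere norm_zero zero_neq_one)
    show "u \<bullet> (Z *v u) * (norm x)\<^sup>2 \<le> x \<bullet> (Z *v x)" for x
    proof (cases "x = 0")
      case False
      define v where "v = (1 / norm x) *\<^sub>R x"
      have x: "x = norm x *\<^sub>R v" using False by (simp add: v_def)
      have "u \<bullet> (Z *v u) \<le> v \<bullet> (Z *v v)"
        using False by (intro u(2)) (simp add: v_def)
      then have "u \<bullet> (Z *v u) * (norm x)\<^sup>2 \<le> (v \<bullet> (Z *v v)) * (norm x)\<^sup>2"
        by (rule mult_right_mono) simp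
      also have "\<dots> = (norm x *\<^sub>R v) \<bullet> (Z *v (norm x *\<^sub>R v))"
        by (simp add: matrix_vector_mult_scaleR power2_eq_square)
      finally show ?thesis using x by simp
    qed simp
  qed
qed

section \<open>Multiple Lyapunov functions force convergence\<close>

text \<open>The form used at time \<open>j\<close> is that of the preceding cycle \<open>c (j - 1)\<close>, so that one application of the
hypothesis relates consecutive values. Since the hypothesis compares every pair of indices, the form at time
\<open>0\<close> can be chosen freely. Telescoping bounds the sum of \<open>\<mu> |y\<^sub>j|\<^sup>2\<close> by the first value.\<close>
lemma switched_lyapunov_tendsto_0:
  fixes \<Phi> P :: "'h \<Rightarrow> real^'n^'n"
  assumes H: "finite H" and P: "\<And>h. h \<in> H \<Longrightarrow> pos_def (P h)"
    and descent: "\<And>h q. h \<in> H \<Longrightarrow> q \<in> H \<Longrightarrow> transpose (\<Phi> h) ** P h ** \<Phi> h - P q \<prec>\<^sub>p\<^sub>d 0"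
    and c: "\<And>j. c j \<in> H" and y: "\<And>j. y (Suc j) = \<Phi> (c j) *v y j"
  shows "y \<longlonglongrightarrow> 0"
proof -
  have "\<forall>p\<in>H \<times> H. \<exists>\<mu>>0. \<forall>x. \<mu> * (norm x)\<^sup>2
          \<le> x \<bullet> ((0 - (transpose (\<Phi> (fst p)) ** P (fst p) ** \<Phi> (fst p) - P (snd p))) *v x)"
    using descent pos_def_lower_bound unfolding pd_less_def by (metis mem_Times_iff)
  then obtain m where m: "\<And>p. p \<in> H \<times> H \<Longrightarrow> m p > 0"
    "\<And>p x. p \<in> H \<times> H \<Longrightarrow> m p * (norm x)\<^sup>2
          \<le> x \<bullet> ((0 - (transpose (\<Phi> (fst p)) ** P (fst p) ** \<Phi> (fst p) - P (snd p))) *v x)"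
    by metis
  define \<mu> where "\<mu> = Min (m ` (H \<times> H))"
  have ne: "m ` (H \<times> H) \<noteq> {}" using c by blast
  have \<mu>: "\<mu> > 0" using H ne m(1) by (simp add: \<mu>_def)
  have step: "(\<Phi> h *v x) \<bullet> (P h *v (\<Phi> h *v x)) + \<mu> * (norm x)\<^sup>2 \<le> x \<bullet> (P q *v x)"
    if "h \<in> H" "q \<in> H" for h q x
  proof -
    have "\<mu> * (norm x)\<^sup>2 \<le> m (h, q) * (norm x)\<^sup>2"
      using that H by (intro mult_right_mono) (auto simp: \<mu>_def)
    also have "\<dots> \<le> x \<bullet> (P q *v x) - x \<bullet> ((transpose (\<Phi> h) ** P h ** \<Phi> h) *v x)"
      using m(2)[of "(h, q)" x] that by (simp add: matrix_vector_mult_diff_rdistrib inner_diff_right)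
    finally show ?thesis unfolding inner_congruence by linarith
  qed
  \<comment> \<open>At \<open>j = 0\<close> truncated subtraction gives \<open>c 0\<close>.\<close>
  define q where "q j = c (j - 1)" for j
  define V where "V j = y j \<bullet> (P (q j) *v y j)" for j
  have q: "q j \<in> H" for j using c by (simp add: q_def)
  have dec: "V (Suc j) + \<mu> * (norm (y j))\<^sup>2 \<le> V j" for j
    using step[OF c[of j] q[of j], of "y j"] by (simp add: V_def y q_def)
  have nonneg: "0 \<le> V j" for j
    using P[OF q[of j]] by (cases "y j = 0") (auto simp: V_def pos_def_def intro: less_imp_le)
  have "(\<Sum>j<n. \<mu> * (norm (y j))\<^sup>2) \<le> V 0 - V n" for n
  proof (induction n)
    case (Suc n)
    then show ?case using dec[of n] by simp
  qed simp
  then have "(\<Sum>j<n. \<mu> * (norm (y j))\<^sup>2) \<le> V 0" for n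
    using nonneg[of n] by (smt (verit))
  then have "summable (\<lambda>j. \<mu> * (norm (y j))\<^sup>2)"
    using \<mu> by (intro summableI_nonneg_bounded) auto
  then have "(\<lambda>j. \<mu> * (norm (y j))\<^sup>2) \<longlonglongrightarrow> 0"
    by (rule summable_LIMSEQ_zero)
  then have "(\<lambda>j. (1 / \<mu>) * (\<mu> * (norm (y j))\<^sup>2)) \<longlonglongrightarrow> 0"
    by (rule tendsto_mult_right_zero)
  then have "(\<lambda>j. sqrt ((norm (y j))\<^sup>2)) \<longlonglongrightarrow> sqrt 0"
    using \<mu> by (intro tendsto_real_sqrt) simp
  then show ?thesis
    by (simp add: tendsto_norm_zero_iff)
qed

lemma solution_tendsto_0_of_samples:
  fixes A :: "nat \<Rightarrow> real^'n^'n"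
  assumes \<sigma>: "range \<sigma> \<subseteq> {1..N}" and s: "s 0 = 0" "strict_mono s" "\<And>j. s (Suc j) \<le> s j + D"
    and lim: "(\<lambda>j. solution A \<sigma> x (s j)) \<longlonglongrightarrow> 0"
  shows "solution A \<sigma> x \<longlonglongrightarrow> 0"
proof (rule LIMSEQ_I)
  obtain K where K: "K \<ge> 1" "\<And>j x. j \<in> {1..N} \<Longrightarrow> norm (A j *v x) \<le> K * norm x"
    using finite_linear_common_bound[of "{1..N}" "\<lambda>j. (*v) (A j)"] by auto
  fix r :: real assume "0 < r"
  then have "0 < r / K ^ D" using K(1) by simp
  then obtain J where J: "\<And>j. J \<le> j \<Longrightarrow> norm (solution A \<sigma> x (s j)) < r / K ^ D"
    using LIMSEQ_D[OF lim] by (metis diff_zero)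
  have "norm (solution A \<sigma> x m) < r" if "s J \<le> m" for m
  proof -
    have "m < s (Suc m)"
      using strict_mono_imp_increasing[OF s(2), of "Suc m"] by simp
    then obtain j where j: "s j \<le> m" "m < s (Suc j)"
      using ex_bracketing_index[of s m "Suc m"] s(1) by auto
    have "s J < s (Suc j)" using j that by simp
    then have "J \<le> j" using s(2) by (simp add: strict_mono_less)
    define p where "p = m - s j"
    have p: "m = s j + p" "p \<le> D" using j s(3)[of j] by (auto simp: p_def)
    have "norm (solution A \<sigma> x m) \<le> K ^ p * norm (solution A \<sigma> x (s j))"
      unfolding p(1) solution_eq_orbit orbit_add
      using K \<sigma> by (intro norm_orbit_le[of "{1..N}"]) (auto simp del: atLeastAtMost_iff)
    also have "\<dots> \<le> K ^ D * norm (solution A \<sigma> x (s j))"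
      using p K by (intro mult_right_mono power_increasing) auto
    also have "\<dots> < K ^ D * (r / K ^ D)"
      using J[OF \<open>J \<le> j\<close>] K by (intro mult_strict_left_mono) auto
    finally show ?thesis using K by simp
  qed
  then show "\<exists>m0. \<forall>m\<ge>m0. norm (solution A \<sigma> x m - 0) < r" by auto
qed

section \<open>Switching cycles as words of blocks\<close>

abbreviation dwell_word :: "nat \<Rightarrow> nat \<Rightarrow> nat \<Rightarrow> nat \<Rightarrow> (nat \<Rightarrow> nat \<times> nat) \<Rightarrow> bool" where
  "dwell_word N \<tau>min \<tau>max \<equiv>
     admissible_word ({1..N} \<times> {\<tau>min..\<tau>max}) (\<lambda>b b'. fst b \<noteq> fst b')"

lemma dwell_word_of_cycle:
  assumes "(i, \<tau>) \<in> switching_cycles N \<tau>min \<tau>max L"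
  shows "dwell_word N \<tau>min \<tau>max L (\<lambda>j. (i (Suc j), \<tau> (Suc j)))"
  using assms
  by (auto simp: admissible_word_def switching_cycles_def index_sequences_def PiE_iff)

lemma cycle_of_dwell_word:
  assumes "dwell_word N \<tau>min \<tau>max L w"
  obtains i \<tau> where "(i, \<tau>) \<in> switching_cycles N \<tau>min \<tau>max L"
    "\<And>j. j < L \<Longrightarrow> w j = (i (Suc j), \<tau> (Suc j))"
proof
  let ?i = "\<lambda>l\<in>{1..L}. fst (w (l - 1))" and ?\<tau> = "\<lambda>l\<in>{1..L}. snd (w (l - 1))"
  have w: "w k \<in> {1..N} \<times> {\<tau>min..\<tau>max}" if "k < L" for k
    using assms that by (simp add: admissible_word_def)
  have ne: "fst (w k) \<noteq> fst (w (Suc k))" if "Suc k < L" for k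
    using assms that by (simp add: admissible_word_def)
  have "?i \<in> index_sequences N L"
    unfolding index_sequences_def
  proof (intro CollectI conjI ballI)
    show "?i \<in> {1..L} \<rightarrow>\<^sub>E {1..N}"
      using w by (fastforce simp: mem_Times_iff)
    show "?i l \<noteq> ?i (Suc l)" if "l \<in> {1..<L}" for l
      using ne[of "l - 1"] that by simp
  qed
  moreover have "?\<tau> \<in> {1..L} \<rightarrow>\<^sub>E {\<tau>min..\<tau>max}"
    using w by (fastforce simp: mem_Times_iff)
  ultimately show "(?i, ?\<tau>) \<in> switching_cycles N \<tau>min \<tau>max L"
    by (simp add: switching_cycles_def)
  show "w j = (?i (Suc j), ?\<tau> (Suc j))" if "j < L" for j
    using that by simp
qed

text \<open>The mode in use at step \<open>k\<close> of a cycle. Cycles are numbered from \<open>1\<close> and words from \<open>0\<close>, hence the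
successors.\<close>
definition cycle_signal :: "(nat \<Rightarrow> nat) \<Rightarrow> (nat \<Rightarrow> nat) \<Rightarrow> nat \<Rightarrow> nat" where
  "cycle_signal i \<tau> k = i (Suc (active_block (\<lambda>j. \<tau> (Suc j)) k))"

lemma sum_from_1: "(\<Sum>s=1..<Suc l. \<tau> s) = (\<Sum>j<l. \<tau> (Suc j))" "(\<Sum>s=1..l. \<tau> s) = (\<Sum>j<l. \<tau> (Suc j))"
  for \<tau> :: "nat \<Rightarrow> nat"
  by (simp_all add: sum.atLeast1_atMost_eq atLeastLessThanSuc_atLeastAtMost)

lemma solution_cycle_signal:
  "solution A (cycle_signal i \<tau>) x (\<Sum>l=1..L. \<tau> l) = cycle_matrix A i \<tau> L *v x"
  unfolding sum_from_1 cycle_matrix_eq_orbit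
  by (rule solution_at_block_end) (simp add: cycle_signal_def active_block_eq)

text \<open>The intervals on the left partition the times of a cycle, so a quantification over blocks and their
times is one over all times.\<close>
lemma all_cycle_steps_iff:
  "(\<forall>l\<in>{1..L}. \<forall>k\<in>{(\<Sum>s=1..<l. \<tau> s)..<(\<Sum>s=1..l. \<tau> s)}. Q (i l) k) \<longleftrightarrow>
   (\<forall>k<(\<Sum>l=1..L. \<tau> l). Q (cycle_signal i \<tau> k) k)"
proof (intro iffI allI ballI impI)
  fix k assume all: "\<forall>l\<in>{1..L}. \<forall>k\<in>{(\<Sum>s=1..<l. \<tau> s)..<(\<Sum>s=1..l. \<tau> s)}. Q (i l) k"
    and k: "k < (\<Sum>l=1..L. \<tau> l)"
  obtain l where l: "l < L" "(\<Sum>j<l. \<tau> (Suc j)) \<le> k" "k < (\<Sum>j<Suc l. \<tau> (Suc j))"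
    using ex_bracketing_index[of "\<lambda>l. \<Sum>j<l. \<tau> (Suc j)" k L] k unfolding sum_from_1 by auto
  then have "cycle_signal i \<tau> k = i (Suc l)"
    by (simp add: cycle_signal_def active_block_eq)
  moreover have "Q (i (Suc l)) k"
    using all[rule_format, of "Suc l" k] l unfolding sum_from_1 by simp
  ultimately show "Q (cycle_signal i \<tau> k) k" by simp
next
  fix l k assume all: "\<forall>k<(\<Sum>l=1..L. \<tau> l). Q (cycle_signal i \<tau> k) k"
    and l: "l \<in> {1..L}" and k: "k \<in> {(\<Sum>s=1..<l. \<tau> s)..<(\<Sum>s=1..l. \<tau> s)}"
  obtain l' where l': "l = Suc l'" using l by (cases l) auto
  have "k < (\<Sum>l=1..L. \<tau> l)"
  proof -
    have "(\<Sum>s=1..l. \<tau> s) \<le> (\<Sum>l=1..L. \<tau> l)" using l by (intro sum_mono2) auto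
    then show ?thesis using k by simp
  qed
  moreover have "cycle_signal i \<tau> k = i l"
    using k active_block_eq[of "\<lambda>j. \<tau> (Suc j)" l' k] unfolding l' sum_from_1
    by (simp add: cycle_signal_def)
  ultimately show "Q (i l) k" using all by metis
qed

section \<open>Quadratic forms along a solution\<close>

lemma stepwise_descent:
  fixes A P :: "nat \<Rightarrow> real^'n^'n"
  assumes "\<And>k. k < T \<Longrightarrow> transpose (A (\<sigma> k)) ** P (k + 1) ** A (\<sigma> k) - P k \<prec>\<^sub>p\<^sub>d 0"
  shows "solution A \<sigma> x T \<bullet> (P T *v solution A \<sigma> x T) \<le> x \<bullet> (P 0 *v x)"
  using assms
proof (induction T)
  case (Suc T)
  let ?z = "solution A \<sigma> x T"
  have "(A (\<sigma> T) *v ?z) \<bullet> (P (T + 1) *v (A (\<sigma> T) *v ?z)) \<le> ?z \<bullet> (P T *v ?z)"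
    using pd_less_0_imp_inner_le[OF Suc.prems[of T], of ?z] unfolding inner_congruence by simp
  then show ?case using Suc by fastforce
qed simp

text \<open>The solution of \<open>P(k) = A\<^sup>T P(k+1) A + \<epsilon> I\<close> with \<open>P(T) = I\<close>, in reversed time: the argument \<open>m\<close> is the
number \<open>T - k\<close> of steps that remain.\<close>
primrec backward_lyapunov :: "(nat \<Rightarrow> real^'n^'n) \<Rightarrow> (nat \<Rightarrow> nat) \<Rightarrow> real \<Rightarrow> nat \<Rightarrow> nat \<Rightarrow> real^'n^'n" where
  "backward_lyapunov A \<sigma> \<epsilon> T 0 = mat 1"
| "backward_lyapunov A \<sigma> \<epsilon> T (Suc m) =
     transpose (A (\<sigma> (T - Suc m))) ** backward_lyapunov A \<sigma> \<epsilon> T m ** A (\<sigma> (T - Suc m)) + \<epsilon> *\<^sub>R mat 1"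

lemma inner_backward_lyapunov_Suc:
  fixes A :: "nat \<Rightarrow> real^'n^'n"
  shows
  "x \<bullet> (backward_lyapunov A \<sigma> \<epsilon> T (Suc m) *v x) =
     (A (\<sigma> (T - Suc m)) *v x) \<bullet> (backward_lyapunov A \<sigma> \<epsilon> T m *v (A (\<sigma> (T - Suc m)) *v x))
     + \<epsilon> * (norm x)\<^sup>2"
proof -
  have "(\<epsilon> *\<^sub>R mat 1 :: real^'n^'n) *v x = \<epsilon> *\<^sub>R x"
    by (simp flip: scaleR_matrix_vector_assoc)
  then show ?thesis
    by (simp add: matrix_vector_mult_add_rdistrib inner_add_right inner_congruence power2_norm_eq_inner)
qed

lemma pos_def_backward_lyapunov:
  assumes "0 < \<epsilon>"
  shows "pos_def (backward_lyapunov A \<sigma> \<epsilon> T m)"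
proof (induction m)
  case 0
  show ?case by (simp add: pos_def_def)
next
  case (Suc m)
  let ?Q = "backward_lyapunov A \<sigma> \<epsilon> T"
  have "transpose (?Q (Suc m)) = ?Q (Suc m)"
    using Suc by (simp add: transpose_add transpose_scalar transpose_congruence pos_def_def)
  moreover have "0 < x \<bullet> (?Q (Suc m) *v x)" if "x \<noteq> 0" for x
  proof -
    have "0 \<le> z \<bullet> (?Q m *v z)" for z
      using Suc by (cases "z = 0") (auto simp: pos_def_def intro: less_imp_le)
    then show ?thesis
      unfolding inner_backward_lyapunov_Suc using assms that by (intro add_nonneg_pos) auto
  qed
  ultimately show ?case by (simp add: pos_def_def)
qed

lemma backward_lyapunov_decreases:
  assumes "0 < \<epsilon>" "k < T"
  shows "transpose (A (\<sigma> k)) ** backward_lyapunov A \<sigma> \<epsilon> T (T - (k + 1)) ** A (\<sigma> k)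
           - backward_lyapunov A \<sigma> \<epsilon> T (T - k) \<prec>\<^sub>p\<^sub>d 0"
proof -
  obtain m where m: "T - k = Suc m" using assms(2) by (cases "T - k") auto
  then have m': "T - (k + 1) = m" "T - Suc m = k" using assms(2) by auto
  have sym: "transpose (backward_lyapunov A \<sigma> \<epsilon> T j) = backward_lyapunov A \<sigma> \<epsilon> T j" for j
    using pos_def_backward_lyapunov[OF assms(1)] unfolding pos_def_def by blast
  show ?thesis
    unfolding m m'(1)
    using assms(1) inner_backward_lyapunov_Suc[of _ A \<sigma> \<epsilon> T m] sym
    by (subst diff_pd_less_0_iff) (auto simp: m'(2) inner_congruence transpose_congruence simp del: backward_lyapunov.simps)
qed

text \<open>The recursion says that the value of the form along a solution drops by exactly \<open>\<epsilon> |y\<^sub>k|\<^sup>2\<close> in step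
\<open>k\<close>, and the final form is the squared norm.\<close>
lemma inner_backward_lyapunov_initial:
  "x \<bullet> (backward_lyapunov A \<sigma> \<epsilon> T T *v x) =
     (norm (solution A \<sigma> x T))\<^sup>2 + \<epsilon> * (\<Sum>k<T. (norm (solution A \<sigma> x k))\<^sup>2)"
proof -
  let ?y = "solution A \<sigma> x"
  have "x \<bullet> (backward_lyapunov A \<sigma> \<epsilon> T T *v x) =
     ?y k \<bullet> (backward_lyapunov A \<sigma> \<epsilon> T (T - k) *v ?y k) + \<epsilon> * (\<Sum>j<k. (norm (?y j))\<^sup>2)"
    if "k \<le> T" for k
    using that
  proof (induction k)
    case (Suc k)
    then have m: "T - k = Suc (T - Suc k)" "T - Suc (T - Suc k) = k" by auto
    have "?y k \<bullet> (backward_lyapunov A \<sigma> \<epsilon> T (T - k) *v ?y k) =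
       ?y (Suc k) \<bullet> (backward_lyapunov A \<sigma> \<epsilon> T (T - Suc k) *v ?y (Suc k)) + \<epsilon> * (norm (?y k))\<^sup>2"
      unfolding m(1) inner_backward_lyapunov_Suc m(2) by simp
    then show ?case using Suc by (simp add: distrib_left)
  qed simp
  from this[of T] show ?thesis by (simp add: power2_norm_eq_inner)
qed

section \<open>Certificates on cycles and stability\<close>

text \<open>Every infinite word of blocks comes from an admissible signal, whose solutions converge, in particular
along the switching times.\<close>
lemma GUAS_imp_uniform_word_contraction:
  fixes A :: "nat \<Rightarrow> real^'n^'n"
  assumes "1 \<le> \<tau>min" and stable: "\<And>\<sigma>. \<sigma> \<in> dwell_signals N \<tau>min \<tau>max \<Longrightarrow> GUAS A \<sigma>"
  obtains L where "L \<ge> 1"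
    "\<And>w x. dwell_word N \<tau>min \<tau>max L w \<Longrightarrow> norm (orbit (dwell_map A) w x L) \<le> norm x / 2"
proof (rule uniform_contraction[of "{1..N} \<times> {\<tau>min..\<tau>max}" "dwell_map A" "\<lambda>b b'. fst b \<noteq> fst b'"])
  fix w x
  assume w: "\<And>n. w n \<in> {1..N} \<times> {\<tau>min..\<tau>max}" "\<And>n. fst (w n) \<noteq> fst (w (Suc n))"
  define i \<tau> \<sigma> where "i = fst \<circ> w" and "\<tau> = snd \<circ> w" and "\<sigma> k = i (active_block \<tau> k)" for k
  have \<tau>: "\<tau> l \<in> {\<tau>min..\<tau>max}" "1 \<le> \<tau> l" for l
    using w(1)[of l] assms(1) by (auto simp: \<tau>_def mem_Times_iff)
  have i: "i l \<in> {1..N}" "i l \<noteq> i (Suc l)" for l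
    using w(1)[of l] w(2)[of l] by (auto simp: i_def mem_Times_iff)
  have "\<sigma> \<in> dwell_signals N \<tau>min \<tau>max"
    unfolding \<sigma>_def using i \<tau>(1) assms(1) by (rule block_signal_in_dwell_signals)
  then have "solution A \<sigma> x \<longlonglongrightarrow> 0"
    by (intro GUAS_imp_tendsto stable)
  then have "(\<lambda>n. solution A \<sigma> x (\<Sum>j<n. \<tau> j)) \<longlonglongrightarrow> 0"
    using LIMSEQ_subseq_LIMSEQ strict_mono_block_ends[of \<tau>, OF \<tau>(2)] by (force simp: o_def)
  moreover have "solution A \<sigma> x (\<Sum>j<n. \<tau> j) = orbit (dwell_map A) w x n" for n
    using solution_at_block_end[of n \<tau> \<sigma> i A x] active_block_eq[of \<tau>]
    by (simp add: \<sigma>_def i_def \<tau>_def)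
  ultimately show "orbit (dwell_map A) w x \<longlonglongrightarrow> 0" by simp
qed (use that linear_dwell_map in auto)

text \<open>The sum of squared norms that multiplies \<open>\<epsilon>\<close> in the initial form has at most \<open>B = L \<tau>max\<close> terms, each at
most \<open>(K\<^sup>B)\<^sup>2 |x|\<^sup>2\<close>, whatever the cycle. A common \<open>\<epsilon>\<close> thus bounds its contribution by
\<open>|x|\<^sup>2 / 2\<close>, while the contraction leaves \<open>|x|\<^sup>2 / 4\<close> for the other term.\<close>
lemma contraction_imp_small_backward_lyapunov:
  fixes A :: "nat \<Rightarrow> real^'n^'n"
  assumes contr: "\<And>i \<tau> x. (i, \<tau>) \<in> switching_cycles N \<tau>min \<tau>max L \<Longrightarrow>
      norm (cycle_matrix A i \<tau> L *v x) \<le> norm x / 2"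
  obtains \<epsilon> where "\<epsilon> > 0"
    "\<And>i \<tau> T. (i, \<tau>) \<in> switching_cycles N \<tau>min \<tau>max L \<Longrightarrow> T = (\<Sum>l=1..L. \<tau> l) \<Longrightarrow>
      backward_lyapunov A (cycle_signal i \<tau>) \<epsilon> T T - mat 1 \<prec>\<^sub>p\<^sub>d 0"
proof -
  obtain K where K: "K \<ge> 1" "\<And>j x. j \<in> {1..N} \<Longrightarrow> norm (A j *v x) \<le> K * norm x"
    using finite_linear_common_bound[of "{1..N}" "\<lambda>j. (*v) (A j)"] by auto
  define B where "B = L * \<tau>max"
  define C where "C = real B * (K ^ B)\<^sup>2"
  have C: "0 \<le> C" by (simp add: C_def)
  define \<epsilon> where "\<epsilon> = 1 / (2 * (C + 1))"
  have \<epsilon>: "0 < \<epsilon>" "\<epsilon> * C \<le> 1/2"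
    using C by (auto simp: \<epsilon>_def field_simps)
  show thesis
  proof (rule that[OF \<epsilon>(1)])
    fix i \<tau> T assume cyc: "(i, \<tau>) \<in> switching_cycles N \<tau>min \<tau>max L" and T: "T = (\<Sum>l=1..L. \<tau> l)"
    let ?\<sigma> = "cycle_signal i \<tau>"
    have "T \<le> B"
      using cyc sum_bounded_above[of "{1..L}" \<tau> \<tau>max]
      by (auto simp: T B_def switching_cycles_def PiE_iff)
    have \<sigma>: "?\<sigma> k \<in> {1..N}" if "k < T" for k
      using all_cycle_steps_iff[of L \<tau> "\<lambda>j k. j \<in> {1..N}" i] cyc that
      by (auto simp: T switching_cycles_def index_sequences_def PiE_iff)
    have bound: "(norm (solution A ?\<sigma> x k))\<^sup>2 \<le> (K ^ B)\<^sup>2 * (norm x)\<^sup>2" if "k < T" for x k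
    proof -
      have "norm (solution A ?\<sigma> x k) \<le> K ^ k * norm x"
        unfolding solution_eq_orbit using K \<sigma> that by (intro norm_orbit_le[of "{1..N}"]) auto
      also have "\<dots> \<le> K ^ B * norm x"
        using K that \<open>T \<le> B\<close> by (intro mult_right_mono power_increasing) auto
      finally show ?thesis
        unfolding power_mult_distrib[symmetric] by (rule power_mono) simp
    qed
    have "x \<bullet> (backward_lyapunov A ?\<sigma> \<epsilon> T T *v x) < x \<bullet> x" if "x \<noteq> 0" for x
    proof -
      have "norm (solution A ?\<sigma> x T) \<le> norm x / 2"
        unfolding T solution_cycle_signal by (rule contr[OF cyc])
      then have "(norm (solution A ?\<sigma> x T))\<^sup>2 \<le> (norm x / 2)\<^sup>2"
        by (rule power_mono) simp
      then have "(norm (solution A ?\<sigma> x T))\<^sup>2 \<le> (norm x)\<^sup>2 / 4"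
        by (simp add: power_divide)
      moreover have "\<epsilon> * (\<Sum>k<T. (norm (solution A ?\<sigma> x k))\<^sup>2) \<le> (norm x)\<^sup>2 / 2"
      proof -
        have "(\<Sum>k<T. (norm (solution A ?\<sigma> x k))\<^sup>2) \<le> of_nat (card {..<T}) * ((K ^ B)\<^sup>2 * (norm x)\<^sup>2)"
          using bound by (intro sum_bounded_above) auto
        also have "\<dots> \<le> C * (norm x)\<^sup>2"
          using \<open>T \<le> B\<close> by (auto simp: C_def mult.assoc intro!: mult_right_mono)
        finally have "\<epsilon> * (\<Sum>k<T. (norm (solution A ?\<sigma> x k))\<^sup>2) \<le> (\<epsilon> * C) * (norm x)\<^sup>2"
          using \<epsilon>(1) by (simp add: mult.assoc)
        also have "\<dots> \<le> 1/2 * (norm x)\<^sup>2"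
          using \<epsilon>(2) by (rule mult_right_mono) simp
        finally show ?thesis by simp
      qed
      moreover have "0 < (norm x)\<^sup>2" using that by simp
      ultimately show ?thesis
        unfolding inner_backward_lyapunov_initial power2_norm_eq_inner[symmetric]
        by linarith
    qed
    then show "backward_lyapunov A ?\<sigma> \<epsilon> T T - mat 1 \<prec>\<^sub>p\<^sub>d 0"
      using pos_def_backward_lyapunov[OF \<epsilon>(1), of A ?\<sigma> T T]
      by (subst diff_pd_less_0_iff) (auto simp: pos_def_def)
  qed
qed

text \<open>The word of the signal is cut into consecutive stretches of \<open>L\<close> blocks; each is a cycle and
hence occurs in the enumeration.\<close>
lemma cycle_certificate_imp_GUAS:
  fixes A P :: "nat \<Rightarrow> real^'n^'n"
  assumes enum: "bij_betw (\<lambda>h. (i h, \<tau> h)) {1..M} (switching_cycles N \<tau>min \<tau>max L)" and L: "L \<ge> 1"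
    and P: "\<And>h. h \<in> {1..M} \<Longrightarrow> pos_def (P h)"
    and descent: "\<And>h q. h \<in> {1..M} \<Longrightarrow> q \<in> {1..M} \<Longrightarrow>
      transpose (cycle_matrix A (i h) (\<tau> h) L) ** P h ** cycle_matrix A (i h) (\<tau> h) L - P q \<prec>\<^sub>p\<^sub>d 0"
    and \<sigma>: "\<sigma> \<in> dwell_signals N \<tau>min \<tau>max"
  shows "GUAS A \<sigma>"
proof (rule tendsto_imp_GUAS)
  fix x
  obtain j t where jt: "\<And>l. j l \<in> {1..N}" "\<And>l. j l \<noteq> j (Suc l)" "\<And>l. t l \<in> {\<tau>min..\<tau>max}" "\<And>l. 1 \<le> t l"
    "\<And>l k. (\<Sum>j<l. t j) \<le> k \<Longrightarrow> k < (\<Sum>j<Suc l. t j) \<Longrightarrow> \<sigma> k = j l"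
    using signal_blocks[OF \<sigma>] by blast
  let ?w = "\<lambda>l. (j l, t l)"
  define s where "s m = (\<Sum>l<m * L. t l)" for m
  have sol: "solution A \<sigma> x (s m) = orbit (dwell_map A) ?w x (m * L)" for m
    unfolding s_def by (rule solution_at_block_end) (use jt(5) in auto)
  have "\<exists>h\<in>{1..M}. \<forall>l<L. ?w (m * L + l) = (i h (Suc l), \<tau> h (Suc l))" for m
  proof -
    have "dwell_word N \<tau>min \<tau>max L (\<lambda>l. ?w (m * L + l))"
      using jt by (auto simp: admissible_word_def)
    then obtain i' \<tau>' where cyc: "(i', \<tau>') \<in> switching_cycles N \<tau>min \<tau>max L"
      and eq: "\<And>l. l < L \<Longrightarrow> ?w (m * L + l) = (i' (Suc l), \<tau>' (Suc l))"
      by (rule cycle_of_dwell_word) blast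
    then obtain h where "h \<in> {1..M}" "(i h, \<tau> h) = (i', \<tau>')"
      using enum unfolding bij_betw_def by (metis (no_types, lifting) imageE)
    then show ?thesis using eq by auto
  qed
  then obtain c where c: "\<And>m. c m \<in> {1..M}"
    "\<And>m l. l < L \<Longrightarrow> ?w (m * L + l) = (i (c m) (Suc l), \<tau> (c m) (Suc l))"
    by metis
  have "(\<lambda>m. solution A \<sigma> x (s m)) \<longlonglongrightarrow> 0"
  proof (rule switched_lyapunov_tendsto_0[of "{1..M}" P "\<lambda>h. cycle_matrix A (i h) (\<tau> h) L" c])
    show "solution A \<sigma> x (s (Suc m)) = cycle_matrix A (i (c m)) (\<tau> (c m)) L *v solution A \<sigma> x (s m)" for m
    proof -
      have "solution A \<sigma> x (s (Suc m)) = orbit (dwell_map A) (\<lambda>l. ?w (m * L + l)) (solution A \<sigma> x (s m)) L"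
        unfolding sol by (simp add: add.commute[of L] orbit_add)
      also have "\<dots> = orbit (dwell_map A) (\<lambda>l. (i (c m) (Suc l), \<tau> (c m) (Suc l))) (solution A \<sigma> x (s m)) L"
        using c(2) by (rule orbit_cong)
      finally show ?thesis by (simp add: cycle_matrix_eq_orbit)
    qed
  qed (use P descent c(1) in auto)
  moreover have "range \<sigma> \<subseteq> {1..N}" using \<sigma> by (simp add: dwell_signals_def)
  moreover have "s 0 = 0" by (simp add: s_def)
  moreover have "strict_mono s"
  proof (rule strict_monoI)
    fix m m' :: nat assume "m < m'"
    then have "m * L < m' * L" using L by simp
    then show "s m < s m'"
      unfolding s_def by (rule strict_monoD[OF strict_mono_block_ends[of t, OF jt(4)]])
  qed
  moreover have "s (Suc m) \<le> s m + L * \<tau>max" for m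
  proof -
    have "(\<Sum>l<m * L + p. t l) = s m + (\<Sum>l<p. t (m * L + l))" for p
      by (induction p) (simp_all add: s_def)
    from this[of L] have "s (Suc m) = s m + (\<Sum>l<L. t (m * L + l))"
      by (simp add: s_def add.commute[of L])
    also have "\<dots> \<le> s m + L * \<tau>max"
      using jt(3) sum_bounded_above[of "{..<L}" "\<lambda>l. t (m * L + l)" \<tau>max] by auto
    finally show ?thesis .
  qed
  ultimately show "solution A \<sigma> x \<longlonglongrightarrow> 0"
    by (intro solution_tendsto_0_of_samples[of \<sigma> N s])
qed

theorem theorem2:
  fixes A :: "nat \<Rightarrow> real^'n^'n"
    and N \<tau>min \<tau>max d :: nat
    and M :: "nat \<Rightarrow> nat"
    and i \<tau> :: "nat \<Rightarrow> nat \<Rightarrow> nat \<Rightarrow> nat"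
    and T :: "nat \<Rightarrow> nat \<Rightarrow> nat"
  assumes N: "N \<ge> 1"
    and dwell: "1 \<le> \<tau>min" "\<tau>min \<le> \<tau>max"
    and d: "d = \<tau>max - \<tau>min + 1"
    and M: "\<And>L. M L = N * (N - 1) ^ (L - 1) * d ^ L"
    and enum: "\<And>L. L \<ge> 1 \<Longrightarrow>
      bij_betw (\<lambda>h. (i L h, \<tau> L h)) {1..M L} (switching_cycles N \<tau>min \<tau>max L)"
    and T: "\<And>L h. T L h = (\<Sum>l=1..L. \<tau> L h l)"
  shows
    "((\<forall>\<sigma>\<in>dwell_signals N \<tau>min \<tau>max. GUAS A \<sigma>) \<longleftrightarrow>
      (\<exists>L\<ge>1. \<exists>P :: nat \<Rightarrow> nat \<Rightarrow> real^'n^'n.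
        (\<forall>h\<in>{1..M L}. \<forall>k\<in>{0..T L h}. pos_def (P h k)) \<and>
        (\<forall>h\<in>{1..M L}. \<forall>l\<in>{1..L}. \<forall>k\<in>{(\<Sum>s=1..<l. \<tau> L h s)..<(\<Sum>s=1..l. \<tau> L h s)}.
          transpose (A (i L h l)) ** P h (k + 1) ** A (i L h l) - P h k \<prec>\<^sub>p\<^sub>d 0) \<and>
        (\<forall>h\<in>{1..M L}. \<forall>q\<in>{1..M L}. P h 0 - P q (T L q) \<prec>\<^sub>p\<^sub>d 0)))
     \<and>
     ((\<forall>\<sigma>\<in>dwell_signals N \<tau>min \<tau>max. GUAS A \<sigma>) \<longleftrightarrow>
      (\<exists>L\<ge>1. \<exists>P :: nat \<Rightarrow> real^'n^'n.
        (\<forall>h\<in>{1..M L}. pos_def (P h)) \<and>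
        (\<forall>h\<in>{1..M L}. \<forall>q\<in>{1..M L}.
          transpose (cycle_matrix A (i L h) (\<tau> L h) L) ** P h ** cycle_matrix A (i L h) (\<tau> L h) L
            - P q \<prec>\<^sub>p\<^sub>d 0)))"
    (is "(?stable \<longleftrightarrow> ?a) \<and> (?stable \<longleftrightarrow> ?b)")
proof -
  note steps = all_cycle_steps_iff[of L "\<tau> L h" "\<lambda>j k. transpose (A j) ** P h (k + 1) ** A j - P h k \<prec>\<^sub>p\<^sub>d 0" "i L h"
      for L h and P :: "nat \<Rightarrow> nat \<Rightarrow> real^'n^'n"]
  have cyc: "(i L h, \<tau> L h) \<in> switching_cycles N \<tau>min \<tau>max L" if "L \<ge> 1" "h \<in> {1..M L}" for L h
    using bij_betwE[OF enum[OF that(1)]] that(2) by blast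
  have a_imp_b: ?b if ?a
  proof -
    obtain L P where L: "L \<ge> 1"
      and pd: "\<And>h k. h \<in> {1..M L} \<Longrightarrow> k \<in> {0..T L h} \<Longrightarrow> pos_def (P h k)"
      and step: "\<And>h k. h \<in> {1..M L} \<Longrightarrow> k < T L h \<Longrightarrow>
        transpose (A (cycle_signal (i L h) (\<tau> L h) k)) ** P h (k + 1) ** A (cycle_signal (i L h) (\<tau> L h) k)
          - P h k \<prec>\<^sub>p\<^sub>d 0"
      and glue: "\<And>h q. h \<in> {1..M L} \<Longrightarrow> q \<in> {1..M L} \<Longrightarrow> P h 0 - P q (T L q) \<prec>\<^sub>p\<^sub>d 0"
      using \<open>?a\<close> unfolding steps T by blast
    have "transpose (cycle_matrix A (i L h) (\<tau> L h) L) ** P h (T L h) ** cycle_matrix A (i L h) (\<tau> L h) L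
            - P q (T L q) \<prec>\<^sub>p\<^sub>d 0" if h: "h \<in> {1..M L}" and q: "q \<in> {1..M L}" for h q
    proof -
      have sym: "transpose (P h k) = P h k" if "h \<in> {1..M L}" "k \<in> {0..T L h}" for h k
        using pd[OF that] by (simp add: pos_def_def)
      have "x \<bullet> ((transpose (cycle_matrix A (i L h) (\<tau> L h) L) ** P h (T L h) ** cycle_matrix A (i L h) (\<tau> L h) L) *v x)
              < x \<bullet> (P q (T L q) *v x)" if "x \<noteq> 0" for x
      proof -
        have "x \<bullet> ((transpose (cycle_matrix A (i L h) (\<tau> L h) L) ** P h (T L h) ** cycle_matrix A (i L h) (\<tau> L h) L) *v x)
              \<le> x \<bullet> (P h 0 *v x)"
          using stepwise_descent[of "T L h" A "cycle_signal (i L h) (\<tau> L h)" "P h" x, OF step[OF h]]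
          unfolding inner_congruence T solution_cycle_signal by simp
        also have "\<dots> < x \<bullet> (P q (T L q) *v x)"
          using glue[OF h q] diff_pd_less_0_iff[OF sym[OF h, of 0] sym[OF q, of "T L q"]] that by simp
        finally show ?thesis .
      qed
      then show ?thesis
        using sym[OF h, of "T L h"] sym[OF q, of "T L q"]
        by (subst diff_pd_less_0_iff) (auto simp: transpose_congruence)
    qed
    then show ?b
      using L pd by (intro exI[of _ L] conjI exI[of _ "\<lambda>h. P h (T L h)"]) auto
  qed
  have b_imp_stable: ?stable if ?b
  proof -
    obtain L and P :: "nat \<Rightarrow> real^'n^'n" where "L \<ge> 1" "\<And>h. h \<in> {1..M L} \<Longrightarrow> pos_def (P h)"
      "\<And>h q. h \<in> {1..M L} \<Longrightarrow> q \<in> {1..M L} \<Longrightarrow>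
        transpose (cycle_matrix A (i L h) (\<tau> L h) L) ** P h ** cycle_matrix A (i L h) (\<tau> L h) L - P q \<prec>\<^sub>p\<^sub>d 0"
      using \<open>?b\<close> by blast
    then show ?stable
      using cycle_certificate_imp_GUAS[OF enum] by blast
  qed
  have stable_imp_a: ?a if ?stable
  proof -
    obtain L where L: "L \<ge> 1"
      and contr: "\<And>w x. dwell_word N \<tau>min \<tau>max L w \<Longrightarrow> norm (orbit (dwell_map A) w x L) \<le> norm x / 2"
      using GUAS_imp_uniform_word_contraction[of \<tau>min N \<tau>max A] dwell(1) \<open>?stable\<close> by blast
    have "norm (cycle_matrix A i' \<tau>' L *v x) \<le> norm x / 2"
      if "(i', \<tau>') \<in> switching_cycles N \<tau>min \<tau>max L" for i' \<tau>' x
      unfolding cycle_matrix_eq_orbit by (intro contr dwell_word_of_cycle that)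
    from contraction_imp_small_backward_lyapunov[of N \<tau>min \<tau>max L A, OF this]
    obtain \<epsilon> where \<epsilon>: "\<epsilon> > 0"
      "\<And>i' \<tau>' T'. (i', \<tau>') \<in> switching_cycles N \<tau>min \<tau>max L \<Longrightarrow> T' = (\<Sum>l=1..L. \<tau>' l) \<Longrightarrow>
        backward_lyapunov A (cycle_signal i' \<tau>') \<epsilon> T' T' - mat 1 \<prec>\<^sub>p\<^sub>d 0"
      by blast
    \<comment> \<open>All cycles end with the identity, so the comparison of \<open>P h 0\<close> with \<open>P q (T L q)\<close> does not depend on \<open>q\<close>.\<close>
    define P where
      "P h k = backward_lyapunov A (cycle_signal (i L h) (\<tau> L h)) \<epsilon> (T L h) (T L h - k)" for h k
    have "pos_def (P h k)" for h k
      unfolding P_def using \<epsilon>(1) by (rule pos_def_backward_lyapunov)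
    moreover have "transpose (A (cycle_signal (i L h) (\<tau> L h) k)) ** P h (k + 1)
        ** A (cycle_signal (i L h) (\<tau> L h) k) - P h k \<prec>\<^sub>p\<^sub>d 0" if "k < T L h" for h k
      unfolding P_def using \<epsilon>(1) that by (rule backward_lyapunov_decreases)
    moreover have "P h 0 - P q (T L q) \<prec>\<^sub>p\<^sub>d 0" if "h \<in> {1..M L}" for h q
      using \<epsilon>(2)[OF cyc[OF L that] T] by (simp add: P_def)
    ultimately show ?a
      using L unfolding steps T by blast
  qed
  show ?thesis using a_imp_b b_imp_stable stable_imp_a by blast
qed

end
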